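(* Assume the Generalized Riemann Hypothesis. Let $k\geq 2$ be an integer. Then there exists a multiplicative function $f:\mathbb{N}\to\{-1,0,1\}$ supported on the $k$-free integers, with $f(p)\in\{-1,1\}$ for every prime $p$, such that for every $\epsilon>0$, $$\sum_{n\leq x}f(n)\ll x^{1/(k+\frac12)+\epsilon},$$ where the implied constant may depend on $\epsilon$.
   Context: $\mathbb{N}$ is the set of positive integers. For an integer $k\ge 2$, an integer $n$ is $k$-free if it is not divisible by $p^k$ for any prime $p$. A function $f:\mathbb{N}\to\mathbb{C}$ is multiplicative if $f(nm)=f(n)f(m)$ whenever $\gcd(n,m)=1$. $f$ is supported on the $k$-free integers if $f(n)=0$ whenever $n$ is not $k$-free. The notation $F(x)\ll G(x)$ means that there is a constant $C>0$ such that $|F(x)|\leq C|G(x)|$ for all sufficiently large real $x>0$. Generalized Riemann Hypothesis: for the Riemann zeta function $\zeta(s)$ and for every Dirichlet $L$-function $L(s,\chi)=\sum_{n=1}^\infty \chi(n)n^{-s}$ ($\chi$ a Dirichlet character), analytically continued, all zeros $s_0$ with $\mathrm{Re}(s_0)>0$ satisfy $\mathrm{Re}(s_0)=1/2$. *)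

theory Defs
  imports
    "HOL-Complex_Analysis.Complex_Analysis"
    "HOL-Library.Landau_Symbols"
    "HOL-Computational_Algebra.Primes"
begin

text \<open>
  Arithmetic functions are functions on \<open>nat\<close> whose value at \<open>0\<close> is irrelevant: conditions
  and sums range over positive arguments only.
\<close>

definition k_free :: "nat \<Rightarrow> nat \<Rightarrow> bool" where
  "k_free k n \<longleftrightarrow> (\<forall>p. prime p \<longrightarrow> \<not> p ^ k dvd n)"

definition supported_on_k_free :: "nat \<Rightarrow> (nat \<Rightarrow> complex) \<Rightarrow> bool" where
  "supported_on_k_free k f \<longleftrightarrow> (\<forall>n>0. \<not> k_free k n \<longrightarrow> f n = 0)"

definition multiplicative :: "(nat \<Rightarrow> complex) \<Rightarrow> bool" where
  "multiplicative f \<longleftrightarrow> (\<forall>m>0. \<forall>n>0. coprime m n \<longrightarrow> f (m * n) = f m * f n)"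

definition dirichlet_character :: "nat \<Rightarrow> (nat \<Rightarrow> complex) \<Rightarrow> bool" where
  "dirichlet_character q chi \<longleftrightarrow>
     q > 0 \<and>
     (\<forall>n. chi (n + q) = chi n) \<and>
     (\<forall>m n. chi (m * n) = chi m * chi n) \<and>
     (\<forall>n. chi n \<noteq> 0 \<longleftrightarrow> coprime n q)"

text \<open>
  \<open>F\<close> is an analytic continuation to the domain \<open>A\<close> of the Dirichlet series with coefficients
  \<open>a\<close>, which is required to converge for \<open>Re s > 1\<close>. As \<open>A\<close> is connected, \<open>F\<close> is
  determined on \<open>A\<close> by \<open>a\<close>.
\<close>

definition continues_dirichlet_series ::
  "(nat \<Rightarrow> complex) \<Rightarrow> complex set \<Rightarrow> (complex \<Rightarrow> complex) \<Rightarrow> bool" where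
  "continues_dirichlet_series a A F \<longleftrightarrow>
     open A \<and> connected A \<and> {s. Re s > 1} \<subseteq> A \<and> F holomorphic_on A \<and>
     (\<forall>s. Re s > 1 \<longrightarrow> (\<lambda>n. a (Suc n) * of_nat (Suc n) powr (- s)) sums F s)"

text \<open>
  The domain is arbitrary so that the possible pole at \<open>s = 1\<close> needs no special treatment: a
  series with a pole there has no continuation to a domain containing \<open>1\<close>, while for the
  other series \<open>s = 1\<close> is a point like any other.
\<close>

definition zeros_on_critical_line :: "(nat \<Rightarrow> complex) \<Rightarrow> bool" where
  "zeros_on_critical_line a \<longleftrightarrow>
     (\<forall>A F s. continues_dirichlet_series a A F \<longrightarrow>
        s \<in> A \<longrightarrow> Re s > 0 \<longrightarrow> F s = 0 \<longrightarrow> Re s = 1 / 2)"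

definition Generalized_Riemann_Hypothesis :: bool where
  "Generalized_Riemann_Hypothesis \<longleftrightarrow>
     zeros_on_critical_line (\<lambda>_. 1) \<and>
     (\<forall>q chi. dirichlet_character q chi \<longrightarrow> zeros_on_critical_line chi)"

end

theory Submission imports Defs "HOL-Computational_Algebra.Squarefree" begin

text \<open>
  Let \<open>g\<close> be the completely multiplicative function that agrees with the nonprincipal character
  modulo 3 away from the multiples of 3 and has \<open>g(3) = 1\<close>, and let \<open>f = g\<close> on the \<open>k\<close>-free
  integers and \<open>f = 0\<close> elsewhere. Then \<open>f(n)\<close> is the sum of \<open>\<mu>(d) g(d)\<^sup>k g(m)\<close> over \<open>n = d\<^sup>k m\<close>.
  The partial sums of \<open>g\<close> are \<open>O(x\<^sup>\<epsilon>)\<close>, and those of \<open>\<mu> g\<^sup>k\<close>, which is \<open>\<mu>\<close> or \<open>\<mu> g\<close> according to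
  the parity of \<open>k\<close>, are \<open>O(x\<^bsup>1/2+\<epsilon>\<^esup>)\<close> under the Riemann hypothesis for the corresponding
  \<open>L\<close>-function; the hyperbola method with the cut at \<open>d = x\<^bsup>1/(k+1/2)\<^esup>\<close> balances the two bounds.

  The bound for \<open>\<mu> g\<^sup>k\<close> is Littlewood's: on a disc around \<open>2 + i t\<close> the logarithm of \<open>L\<close> is
  \<open>O(log t)\<close> by the Borel--Caratheodory inequality and bounded near the centre, so that
  \<open>1 / L(s) = O(\<bar>t\<bar>\<^sup>\<epsilon>)\<close> to the right of the critical line, and Perron's formula applies.
\<close>

section \<open>Truncated Perron formula\<close>

text \<open>A nonprincipal character vanishes at the primes dividing its modulus, which the
  prescribed values at primes forbid. Setting g(3) = 1 repairs this at the price of the Euler factor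
  1 / (1 - 3^(-s)), which has neither zeros nor poles for Re s > 0, so that g inherits its zeros
  there from the character. The partial sums stop being bounded, but only by a logarithm. The
  exponent comes from a balance. With a cut at d = y the small d cost y. Beyond it m \<le> x / y^k,
  and square-root cancellation over d costs (x/m)^(1/(2k)) for each m, in total x / y^(k - 1/2). The
  two agree when y^(k + 1/2) = x. The pole of zeta at 1 shapes the analytic statements: the
  logarithm is needed only away from it, whereas the contour shift needs the reciprocal on the whole
  half-plane. Hence they carry a pair: \<open>L\<close>, possibly with a pole at 1, and
  \<open>G\<close>, which continues its reciprocal across 1.\<close>

lemma contour_integral_rectpath_split:
  assumes "continuous_on (path_image (rectpath a c)) f"
  shows "contour_integral (rectpath a c) f =
     contour_integral (linepath a (Complex (Re c) (Im a))) f
   + contour_integral (linepath (Complex (Re c) (Im a)) c) f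
   + contour_integral (linepath c (Complex (Re a) (Im c))) f
   + contour_integral (linepath (Complex (Re a) (Im c)) a) f"
proof -
  have *: "f contour_integrable_on linepath u v" if "closed_segment u v \<subseteq> path_image (rectpath a c)" for u v
    using assms that by (intro contour_integrable_continuous_linepath) (rule continuous_on_subset)
  have "f contour_integrable_on linepath a (Complex (Re c) (Im a))"
       "f contour_integrable_on linepath (Complex (Re c) (Im a)) c"
       "f contour_integrable_on linepath c (Complex (Re a) (Im c))"
       "f contour_integrable_on linepath (Complex (Re a) (Im c)) a"
    by (rule *; auto simp: rectpath_def Let_def path_image_join)+
  then show ?thesis
    by (simp add: rectpath_def Let_def contour_integrable_joinI)
qed

text \<open>
  Integrating by parts replaces \<open>1 / s\<close> by \<open>1 / s\<^sup>2\<close>, after which bounding the integrand by its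
  supremum loses nothing even on segments of length comparable to \<open>T\<close>.
\<close>

lemma norm_contour_integral_exp_over_id:
  fixes l T M :: real
  assumes "l \<noteq> 0" "T > 0"
    and far: "\<And>s. s \<in> closed_segment a b \<Longrightarrow> T \<le> norm s"
    and M: "\<And>s. s \<in> closed_segment a b \<Longrightarrow> exp (l * Re s) \<le> M"
  shows "norm (contour_integral (linepath a b) (\<lambda>s. exp (of_real l * s) / s))
           \<le> M / \<bar>l\<bar> * (2 / T + norm (b - a) / T ^ 2)"
proof -
  let ?S = "closed_segment a b"
  let ?F = "\<lambda>s::complex. exp (of_real l * s) / (of_real l * s)"
  let ?h = "\<lambda>s::complex. exp (of_real l * s) / (of_real l * s ^ 2)"
  have nz: "s \<noteq> 0" if "s \<in> ?S" for s
    using far[OF that] assms(2) by auto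
  have M0: "M \<ge> 0"
    using order_trans[OF exp_ge_zero M[of a]] by simp
  have bF: "norm (?F s) \<le> M / \<bar>l\<bar> * (1 / T)" if "s \<in> ?S" for s
  proof -
    have "norm (?F s) = exp (l * Re s) / (\<bar>l\<bar> * norm s)"
      by (simp add: norm_divide norm_mult)
    also have "\<dots> \<le> M / (\<bar>l\<bar> * T)"
      using far[OF that] M[OF that] assms M0 by (intro frac_le mult_left_mono) auto
    finally show ?thesis by simp
  qed
  have bh: "norm (?h s) \<le> M / (\<bar>l\<bar> * T ^ 2)" if "s \<in> ?S" for s
  proof -
    have "norm (?h s) = exp (l * Re s) / (\<bar>l\<bar> * norm s ^ 2)"
      by (simp add: norm_divide norm_mult norm_power)
    also have "\<dots> \<le> M / (\<bar>l\<bar> * T ^ 2)"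
      using far[OF that] M[OF that] assms M0 by (intro frac_le mult_left_mono power_mono) auto
    finally show ?thesis .
  qed
  have "((\<lambda>s. exp (of_real l * s) / s - ?h s) has_contour_integral (?F (pathfinish (linepath a b)) - ?F (pathstart (linepath a b)))) (linepath a b)"
  proof (rule contour_integral_primitive[where S = ?S])
    fix s assume "s \<in> ?S"
    then have "s \<noteq> 0" by (rule nz)
    then show "(?F has_field_derivative exp (of_real l * s) / s - ?h s) (at s within ?S)"
      using assms(1) by (auto intro!: derivative_eq_intros simp: field_simps power2_eq_square)
  qed auto
  then have 1: "((\<lambda>s. exp (of_real l * s) / s - ?h s) has_contour_integral (?F b - ?F a)) (linepath a b)"
    by simp
  have "continuous_on ?S ?h"
    using nz assms(1) by (intro continuous_intros) auto
  then have hi: "?h contour_integrable_on linepath a b"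
    by (rule contour_integrable_continuous_linepath)
  from has_contour_integral_add[OF 1 has_contour_integral_integral[OF hi]]
  have "contour_integral (linepath a b) (\<lambda>s. exp (of_real l * s) / s)
      = ?F b - ?F a + contour_integral (linepath a b) ?h"
    by (intro contour_integral_unique) simp
  also have "norm \<dots> \<le> norm (?F b) + norm (?F a) + norm (contour_integral (linepath a b) ?h)"
    by (intro order_trans[OF norm_triangle_ineq] add_mono norm_triangle_ineq4 order_refl)
  also have "\<dots> \<le> M / \<bar>l\<bar> * (1 / T) + M / \<bar>l\<bar> * (1 / T) + M / (\<bar>l\<bar> * T ^ 2) * norm (b - a)"
    using M0 by (intro add_mono bF contour_integral_bound_linepath[OF hi] bh) auto
  also have "\<dots> = M / \<bar>l\<bar> * (2 / T + norm (b - a) / T ^ 2)"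
    using assms(1,2) by (simp add: field_simps)
  finally show ?thesis .
qed

text \<open>Both terms of the previous bound are at most \<open>2 / T\<close> on segments no longer
  than \<open>2 * T\<close>. The sides of the boxes below qualify, since
  \<open>T + 2 \<le> 2 * T\<close> for \<open>T \<ge> 2\<close>.\<close>

lemma norm_contour_integral_exp_over_id':
  fixes l T M :: real
  assumes "l \<noteq> 0" "T > 0" "norm (b - a) \<le> 2 * T"
    and "\<And>s. s \<in> closed_segment a b \<Longrightarrow> T \<le> norm s"
    and "\<And>s. s \<in> closed_segment a b \<Longrightarrow> exp (l * Re s) \<le> M"
  shows "norm (contour_integral (linepath a b) (\<lambda>s. exp (of_real l * s) / s)) \<le> 4 * M / (\<bar>l\<bar> * T)"
proof -
  have M0: "M \<ge> 0"
    using order_trans[OF exp_ge_zero assms(5)[of a]] by simp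
  have "norm (contour_integral (linepath a b) (\<lambda>s. exp (of_real l * s) / s))
          \<le> M / \<bar>l\<bar> * (2 / T + norm (b - a) / T ^ 2)"
    by (rule norm_contour_integral_exp_over_id) (use assms in auto)
  also have "\<dots> \<le> M / \<bar>l\<bar> * (2 / T + 2 * T / T ^ 2)"
    using assms M0 by (intro mult_left_mono add_mono divide_right_mono) auto
  also have "\<dots> = 4 * M / (\<bar>l\<bar> * T)"
    using assms(1,2) by (simp add: field_simps power2_eq_square)
  finally show ?thesis .
qed

lemma cmod_Complex_0: "cmod (Complex x 0) = \<bar>x\<bar>" "cmod (Complex 0 y) = \<bar>y\<bar>"
  by (simp_all add: complex_norm)

lemma le_norm_complex_Re: "T \<le> \<bar>Re s\<bar> \<Longrightarrow> T \<le> norm s"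
  using abs_Re_le_cmod[of s] by linarith

lemma le_norm_complex_Im: "T \<le> \<bar>Im s\<bar> \<Longrightarrow> T \<le> norm s"
  using abs_Im_le_cmod[of s] by linarith

text \<open>Closing the segment to the left keeps \<open>exp (l * Re s)\<close> at most
  \<open>exp (2 * l)\<close> and encloses the simple pole at 0, whose residue is 1. The box extends
  to \<open>Re s = -T\<close> so that its other three sides stay at distance at least
  \<open>T\<close> from 0.\<close>

lemma perron_kernel_gt:
  fixes l T :: real
  assumes l: "l > 0" and T: "T \<ge> 2"
  shows "norm (contour_integral (linepath (Complex 2 (-T)) (Complex 2 T))
            (\<lambda>s. exp (of_real l * s) / s) - 2 * pi * \<i>) \<le> 12 * exp (2 * l) / (l * T)"
proof -
  let ?f = "\<lambda>s::complex. exp (of_real l * s) / s"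
  let ?P = "rectpath (Complex (-T) (-T)) (Complex 2 T)"
  let ?I = "\<lambda>a b. contour_integral (linepath a b) ?f"
  have box: "0 \<in> box (Complex (-T) (-T)) (Complex 2 T)"
    using T by (auto simp: in_box_complex_iff)
  have nz: "0 \<notin> path_image ?P"
    using box T by (subst path_image_rectpath_cbox_minus_box) auto
  have "((\<lambda>w. exp (of_real l * w) / (w - 0)) has_contour_integral
          (2*pi * \<i> * winding_number ?P 0 * exp (of_real l * 0))) ?P"
    by (rule Cauchy_integral_formula_convex_simple[where S = UNIV])
       (use nz in \<open>auto intro!: holomorphic_intros\<close>)
  then have "contour_integral ?P ?f = 2 * pi * \<i>"
    using winding_number_rectpath[OF box] by (intro contour_integral_unique) simp
  moreover have "continuous_on (path_image ?P) ?f"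
    using nz by (intro continuous_intros) auto
  ultimately have "?I (Complex (-T) (-T)) (Complex 2 (-T)) + ?I (Complex 2 (-T)) (Complex 2 T)
       + ?I (Complex 2 T) (Complex (-T) T) + ?I (Complex (-T) T) (Complex (-T) (-T)) = 2 * pi * \<i>"
    by (simp add: contour_integral_rectpath_split)
  then have "?I (Complex 2 (-T)) (Complex 2 T) - 2 * pi * \<i>
     = - (?I (Complex (-T) (-T)) (Complex 2 (-T)) + ?I (Complex 2 T) (Complex (-T) T)
          + ?I (Complex (-T) T) (Complex (-T) (-T)))" (is "?lhs = - (?a + ?b + ?c)")
    by (simp add: algebra_simps)
  then have "norm ?lhs = norm (?a + ?b + ?c)"
    by (simp only: norm_minus_cancel)
  moreover have "norm (?a + ?b + ?c) \<le> norm ?a + norm ?b + norm ?c"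
    by (intro order_trans[OF norm_triangle_ineq] add_mono norm_triangle_ineq order_refl)
  moreover have le: "exp (l * Re s) \<le> exp (2 * l)" if "Re s \<le> 2" for s
    using l that by (simp add: mult.commute)
  have lT: "- (l * T) \<le> 2 * l"
  proof -
    have "0 \<le> l * T"
      using l T by simp
    then show ?thesis
      using l by linarith
  qed
  have e: "12 * exp (2 * l) / (\<bar>l\<bar> * T) = 4 * exp (2 * l) / (\<bar>l\<bar> * T)
      + 4 * exp (2 * l) / (\<bar>l\<bar> * T) + 4 * exp (2 * l) / (\<bar>l\<bar> * T)"
    by simp
  have "norm ?a \<le> 4 * exp (2 * l) / (\<bar>l\<bar> * T)"
    by (rule norm_contour_integral_exp_over_id')
       (use l T in \<open>auto simp: closed_segment_same_Im closed_segment_eq_real_ivl complex_diff cmod_Complex_0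
           split: if_splits simp del: exp_le_cancel_iff intro!: le le_norm_complex_Im\<close>)
  moreover have "norm ?b \<le> 4 * exp (2 * l) / (\<bar>l\<bar> * T)"
    by (rule norm_contour_integral_exp_over_id')
       (use l T in \<open>auto simp: closed_segment_same_Im closed_segment_eq_real_ivl complex_diff cmod_Complex_0
           split: if_splits simp del: exp_le_cancel_iff intro!: le le_norm_complex_Im\<close>)
  moreover have "norm ?c \<le> 4 * exp (2 * l) / (\<bar>l\<bar> * T)"
    by (rule norm_contour_integral_exp_over_id')
       (use l T lT in \<open>auto simp: closed_segment_same_Re closed_segment_eq_real_ivl complex_diff cmod_Complex_0
           split: if_splits simp del: exp_le_cancel_iff intro!: le le_norm_complex_Re\<close>)
  ultimately have "norm ?lhs \<le> 12 * exp (2 * l) / (\<bar>l\<bar> * T)"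
    unfolding e by linarith
  then show ?thesis
    using l by simp
qed

text \<open>For negative \<open>l\<close> the exponential decays to the right, and a box on that
  side leaves the pole outside. Its three new sides again keep distance \<open>T\<close> from
  0.\<close>

lemma perron_kernel_lt:
  fixes l T :: real
  assumes l: "l < 0" and T: "T \<ge> 2"
  shows "norm (contour_integral (linepath (Complex 2 (-T)) (Complex 2 T))
            (\<lambda>s. exp (of_real l * s) / s)) \<le> 12 * exp (2 * l) / (\<bar>l\<bar> * T)"
proof -
  let ?f = "\<lambda>s::complex. exp (of_real l * s) / s"
  let ?P = "rectpath (Complex 2 (-T)) (Complex (T + 2) T)"
  let ?I = "\<lambda>a b. contour_integral (linepath a b) ?f"
  have sub: "path_image ?P \<subseteq> {s. Re s > 0}"
    using path_image_rectpath_subset_cbox[of "Complex 2 (-T)" "Complex (T + 2) T"] T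
    by (auto simp: in_cbox_complex_iff)
  have "(?f has_contour_integral 0) ?P"
    by (rule Cauchy_theorem_convex_simple[where S = "{s. Re s > 0}"])
       (use sub in \<open>auto intro!: holomorphic_intros convex_halfspace_Re_gt\<close>)
  then have "contour_integral ?P ?f = 0"
    by (rule contour_integral_unique)
  moreover have "continuous_on (path_image ?P) ?f"
    using sub by (intro continuous_intros) auto
  ultimately have "?I (Complex 2 (-T)) (Complex (T+2) (-T)) + ?I (Complex (T+2) (-T)) (Complex (T+2) T)
       + ?I (Complex (T+2) T) (Complex 2 T) + ?I (Complex 2 T) (Complex 2 (-T)) = 0"
    by (simp add: contour_integral_rectpath_split)
  moreover have "?I (Complex 2 T) (Complex 2 (-T)) = - ?I (Complex 2 (-T)) (Complex 2 T)"
    using T by (intro contour_integral_reverse_linepath continuous_intros)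
      (auto simp: closed_segment_same_Re)
  ultimately have "?I (Complex 2 (-T)) (Complex 2 T)
     = (?I (Complex 2 (-T)) (Complex (T+2) (-T)) + ?I (Complex (T+2) (-T)) (Complex (T+2) T)
       + ?I (Complex (T+2) T) (Complex 2 T))" (is "?lhs = ?a + ?b + ?c")
    by (simp add: algebra_simps)
  then have "norm ?lhs = norm (?a + ?b + ?c)"
    by (rule arg_cong)
  moreover have "norm (?a + ?b + ?c) \<le> norm ?a + norm ?b + norm ?c"
    by (intro order_trans[OF norm_triangle_ineq] add_mono norm_triangle_ineq order_refl)
  moreover have le: "exp (l * Re s) \<le> exp (2 * l)" if "Re s \<ge> 2" for s
    using l that by (simp add: mult.commute)
  have e: "12 * exp (2 * l) / (\<bar>l\<bar> * T) = 4 * exp (2 * l) / (\<bar>l\<bar> * T)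
      + 4 * exp (2 * l) / (\<bar>l\<bar> * T) + 4 * exp (2 * l) / (\<bar>l\<bar> * T)"
    by simp
  have "norm ?a \<le> 4 * exp (2 * l) / (\<bar>l\<bar> * T)"
    by (rule norm_contour_integral_exp_over_id')
       (use l T in \<open>auto simp: closed_segment_same_Im closed_segment_eq_real_ivl complex_diff cmod_Complex_0
           split: if_splits simp del: exp_le_cancel_iff intro!: le le_norm_complex_Im\<close>)
  moreover have "norm ?b \<le> 4 * exp (2 * l) / (\<bar>l\<bar> * T)"
    by (rule norm_contour_integral_exp_over_id')
       (use l T in \<open>auto simp: closed_segment_same_Re closed_segment_eq_real_ivl complex_diff cmod_Complex_0
           split: if_splits simp del: exp_le_cancel_iff intro!: le le_norm_complex_Re\<close>)
  moreover have "norm ?c \<le> 4 * exp (2 * l) / (\<bar>l\<bar> * T)"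
    by (rule norm_contour_integral_exp_over_id')
       (use l T in \<open>auto simp: closed_segment_same_Im closed_segment_eq_real_ivl complex_diff cmod_Complex_0
           split: if_splits simp del: exp_le_cancel_iff intro!: le le_norm_complex_Im\<close>)
  ultimately show ?thesis
    unfolding e by linarith
qed

text \<open>Since \<open>\<sigma> \<ge> 1 / 2\<close>, twice the norm of \<open>s\<close> is at
  least \<open>sqrt ((2 * Im s)\<^sup>2 + 1)\<close>, so the reciprocal is dominated by a function
  with the exact primitive \<open>arsinh\<close>. This gives the logarithmic loss in
  \<open>T\<close> without a separate treatment of small imaginary parts.\<close>

lemma norm_contour_integral_vertical_over_id:
  fixes \<sigma> T B :: real
  assumes \<sigma>: "\<sigma> \<ge> 1 / 2" and T: "T > 0"
    and g: "continuous_on (closed_segment (Complex \<sigma> T) (Complex \<sigma> (-T))) g"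
    and B: "\<And>s. s \<in> closed_segment (Complex \<sigma> T) (Complex \<sigma> (-T)) \<Longrightarrow> norm (g s) \<le> B"
  shows "norm (contour_integral (linepath (Complex \<sigma> T) (Complex \<sigma> (-T))) (\<lambda>s. g s / s))
           \<le> 2 * B * arsinh (2 * T)"
proof -
  let ?a = "Complex \<sigma> T" and ?b = "Complex \<sigma> (-T)"
  let ?S = "closed_segment ?a ?b"
  let ?w = "\<lambda>u. B * (4 * T / sqrt ((2 * T * (1 - 2 * u))\<^sup>2 + 1))"
  have S: "s \<in> ?S \<Longrightarrow> Re s = \<sigma>" for s
    by (auto simp: closed_segment_same_Re)
  have "\<forall>s\<in>?S. s \<noteq> 0"
    using S \<sigma> by fastforce
  then have "continuous_on ?S (\<lambda>s. g s / s)"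
    by (rule continuous_on_divide[OF g continuous_on_id])
  then have "(\<lambda>s. g s / s) contour_integrable_on linepath ?a ?b"
    by (rule contour_integrable_continuous_linepath)
  from has_contour_integral_integral[OF this]
  have 1: "((\<lambda>u. g (linepath ?a ?b u) / linepath ?a ?b u * (?b - ?a)) has_integral
      contour_integral (linepath ?a ?b) (\<lambda>s. g s / s)) {0..1}"
    by (simp only: has_contour_integral_linepath)
  have 2: "(?w has_integral (- B * arsinh (2 * T * (1 - 2 * 1)) - (- B * arsinh (2 * T * (1 - 2 * 0))))) {0..1}"
  proof (rule fundamental_theorem_of_calculus)
    fix u :: real
    show "((\<lambda>u. - B * arsinh (2 * T * (1 - 2 * u))) has_vector_derivative ?w u) (at u within {0..1})"
      unfolding has_real_derivative_iff_has_vector_derivative[symmetric]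
      by (rule DERIV_cong[OF DERIV_cmult[OF DERIV_chain'[OF _ arsinh_real_has_field_derivative]]])
         (auto intro!: derivative_eq_intros)
  qed simp
  have "norm (contour_integral (linepath ?a ?b) (\<lambda>s. g s / s))
      = norm (integral {0..1} (\<lambda>u. g (linepath ?a ?b u) / linepath ?a ?b u * (?b - ?a)))"
    using 1 by (simp add: integral_unique)
  also have "\<dots> \<le> integral {0..1} ?w"
  proof (rule integral_norm_bound_integral)
    fix u :: real assume u: "u \<in> {0..1}"
    let ?s = "linepath ?a ?b u"
    have s: "?s \<in> ?S"
      using u by (simp add: linepath_in_path)
    have Re: "Re ?s = \<sigma>" and Im: "Im ?s = T * (1 - 2 * u)"
      by (auto simp: linepath_def algebra_simps)
    have ba: "norm (?b - ?a) = 2 * T"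
      using T by (simp add: complex_diff cmod_Complex_0)
    have le: "sqrt ((2 * T * (1 - 2 * u))\<^sup>2 + 1) \<le> 2 * norm ?s"
    proof (rule real_le_lsqrt)
      have "(1/2)\<^sup>2 \<le> \<sigma>\<^sup>2"
        using \<sigma> by (intro power_mono) auto
      then show "(2 * T * (1 - 2 * u))\<^sup>2 + 1 \<le> (2 * norm ?s)\<^sup>2"
        unfolding power_mult_distrib cmod_power2 Re Im by (simp add: power2_eq_square)
    qed simp
    have pos: "sqrt ((2 * T * (1 - 2 * u))\<^sup>2 + 1) > 0"
      by (simp add: add_nonneg_pos)
    have "norm (g ?s / ?s * (?b - ?a)) = norm (g ?s) * (4 * T / (2 * norm ?s))"
      by (simp add: norm_mult norm_divide ba)
    also have "\<dots> \<le> B * (4 * T / sqrt ((2 * T * (1 - 2 * u))\<^sup>2 + 1))"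
      using B[OF s] le pos T by (intro mult_mono frac_le) (auto intro: order_trans[OF norm_ge_zero])
    finally show "norm (g ?s / ?s * (?b - ?a)) \<le> ?w u" .
  qed (use 1 2 in auto)
  also have "\<dots> = 2 * B * arsinh (2 * T)"
    using 2 by (simp add: integral_unique)
  finally show ?thesis .
qed

text \<open>A half-integer stays at distance at least 1/2 from every integer, which keeps
  \<open>ln (x / n)\<close> away from 0, where the kernel bounds blow up. The inequality
  \<open>ln y \<le> y - 1\<close> converts this distance on either side.\<close>

lemma ln_half_integer_bounds:
  fixes N n :: nat
  assumes N: "N \<ge> 1" and n: "n \<ge> 1"
  defines "x \<equiv> real N + 1 / 2"
  shows "n \<le> N \<Longrightarrow> 1 / (4 * x) \<le> ln x - ln (real n)"
    and "n > N \<Longrightarrow> 1 / (4 * x) \<le> ln (real n) - ln x"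
proof -
  have x: "x > 0" by (simp add: x_def add_nonneg_pos)
  show "1 / (4 * x) \<le> ln x - ln (real n)" if "n \<le> N"
  proof -
    have "1 / (4 * x) \<le> 1 - real n / x"
      using that x by (simp add: field_simps) (simp add: x_def)
    also have "ln (real n / x) \<le> real n / x - 1"
      using n x by (intro ln_le_minus_one) auto
    then have "1 - real n / x \<le> ln x - ln (real n)"
      using n x by (simp add: ln_div)
    finally show ?thesis .
  qed
  show "1 / (4 * x) \<le> ln (real n) - ln x" if "n > N"
  proof -
    have "real n \<ge> x + 1 / 2"
      using that by (simp add: x_def)
    then have "x / real n \<le> x / (x + 1 / 2)"
      using x by (intro divide_left_mono) auto
    also have "x / (x + 1 / 2) \<le> 1 - 1 / (4 * x)"
      using x N by (simp add: field_simps) (simp add: x_def)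
    finally have "1 / (4 * x) \<le> 1 - x / real n"
      by simp
    also have "ln (x / real n) \<le> x / real n - 1"
      using n x by (intro ln_le_minus_one) auto
    then have "1 - x / real n \<le> ln (real n) - ln x"
      using n x by (simp add: ln_div)
    finally show ?thesis .
  qed
qed

definition zeta2 :: real where "zeta2 = (\<Sum>n. 1 / real (Suc n) ^ 2)"

lemma summable_inverse_squares: "summable (\<lambda>n. 1 / real (Suc n) ^ 2)"
proof -
  have "summable (\<lambda>n. inverse (real n ^ 2))"
    by (rule inverse_power_summable) simp
  from iffD2[OF summable_Suc_iff this] show ?thesis
    by (simp add: inverse_eq_divide)
qed

lemma of_nat_Suc_powr_minus: "of_nat (Suc n) powr (- s) = (exp (- s * of_real (ln (real (Suc n)))) :: complex)"
  by (simp add: powr_def Ln_of_nat del: of_nat_Suc)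

text \<open>On \<open>Re s = 2\<close> the series converges uniformly, so it may be integrated term
  by term. Each term carries the kernel with \<open>l = ln (x / n)\<close>, which counts
  \<open>a n\<close> when \<open>n < x\<close> and discards it when \<open>n > x\<close>; no term
  sits on the jump.\<close>

lemma truncated_perron:
  fixes a :: "nat \<Rightarrow> complex" and G :: "complex \<Rightarrow> complex" and N :: nat and T :: real
  assumes a: "\<And>n. norm (a n) \<le> 1"
    and G: "\<And>s. Re s = 2 \<Longrightarrow> (\<lambda>n. a (Suc n) * of_nat (Suc n) powr (- s)) sums G s"
    and N: "N \<ge> 1" and T: "T \<ge> 2"
  defines "x \<equiv> real N + 1 / 2"
  shows "norm (contour_integral (linepath (Complex 2 (-T)) (Complex 2 T))
                 (\<lambda>s. G s * exp (of_real (ln x) * s) / s)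
               - 2 * pi * \<i> * (\<Sum>n=1..N. a n)) \<le> 48 * zeta2 * x ^ 3 / T"
proof -
  define L where "L = linepath (Complex 2 (-T)) (Complex 2 T)"
  define l where "l = (\<lambda>n. ln x - ln (real (Suc n)))"
  define J where "J = (\<lambda>n. contour_integral L (\<lambda>s. exp (of_real (l n) * s) / s))"
  define d where "d = (\<lambda>n. if Suc n \<le> N then 2 * pi * \<i> else 0)"
  have x: "x > 0" by (simp add: x_def add_nonneg_pos)
  have img: "Re s = 2" if "s \<in> path_image L" for s
    using that T by (auto simp: L_def closed_segment_same_Re)
  have term_eq: "a (Suc n) * of_nat (Suc n) powr (- s) * exp (of_real (ln x) * s) / s
      = a (Suc n) * (exp (of_real (l n) * s) / s)" for n s
    unfolding of_nat_Suc_powr_minus l_def by (simp add: algebra_simps exp_diff exp_minus field_simps)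
  have cont: "continuous_on (path_image L) (\<lambda>s. exp (of_real (l n) * s) / s)" for n
    using img by (intro continuous_intros) force
  have int: "(\<lambda>s. exp (of_real (l n) * s) / s) contour_integrable_on L" for n
    using cont[of n] unfolding L_def by (intro contour_integrable_continuous_linepath) auto
  have expl: "exp (2 * l n) = x ^ 2 / real (Suc n) ^ 2" for n
  proof -
    have "exp (2 * l n) = exp (l n) ^ 2"
      by (simp add: exp_double)
    also have "exp (l n) = x / real (Suc n)"
      using x by (simp add: l_def exp_diff)
    finally show ?thesis by (simp add: power_divide)
  qed
  \<comment> \<open>The factor \<open>x ^ 3\<close> is \<open>x ^ 2\<close> from
    \<open>exp (2 * l n)\<close> times \<open>4 * x\<close> from the reciprocal of
    \<open>l n\<close>. It is crude, but the later choice of \<open>T\<close> absorbs it.\<close>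
  have Jd: "norm (J n - d n) \<le> 48 * x ^ 3 / T * (1 / real (Suc n) ^ 2)" for n
  proof -
    have ln: "\<bar>l n\<bar> \<ge> 1 / (4 * x)" "l n \<noteq> 0" "l n > 0 \<longleftrightarrow> Suc n \<le> N"
    proof -
      have x4: "1 / (4 * x) > 0" using x by simp
      show "\<bar>l n\<bar> \<ge> 1 / (4 * x)" "l n \<noteq> 0" "l n > 0 \<longleftrightarrow> Suc n \<le> N"
        using ln_half_integer_bounds[OF N, of "Suc n"] x4 unfolding l_def x_def
        by (cases "Suc n \<le> N"; force)+
    qed
    have "norm (J n - d n) \<le> 12 * exp (2 * l n) / (\<bar>l n\<bar> * T)"
    proof (cases "Suc n \<le> N")
      case True
      then show ?thesis
        using perron_kernel_gt[of "l n" T] ln T by (simp add: J_def d_def L_def)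
    next
      case False
      then show ?thesis
        using perron_kernel_lt[of "l n" T] ln T by (simp add: J_def d_def L_def)
    qed
    also have "\<dots> \<le> 12 * exp (2 * l n) / (1 / (4 * x) * T)"
      using ln T x by (intro divide_left_mono mult_right_mono) auto
    also have "\<dots> = 48 * x ^ 3 / T * (1 / real (Suc n) ^ 2)"
      using x T unfolding expl by (simp add: field_simps power2_eq_square power3_eq_cube)
    finally show ?thesis .
  qed
  have lim: "((\<lambda>M. contour_integral L (\<lambda>s. \<Sum>n<M. a (Suc n) * (exp (of_real (l n) * s) / s)))
        \<longlongrightarrow> contour_integral L (\<lambda>s. \<Sum>n. a (Suc n) * (exp (of_real (l n) * s) / s))) sequentially"
  proof (rule contour_integral_uniform_limit(2))
    show "uniform_limit (path_image L) (\<lambda>M s. \<Sum>n<M. a (Suc n) * (exp (of_real (l n) * s) / s))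
            (\<lambda>s. \<Sum>n. a (Suc n) * (exp (of_real (l n) * s) / s)) sequentially"
    proof (rule Weierstrass_m_test)
      fix n s assume s: "s \<in> path_image L"
      have "norm s \<ge> 1"
        using img[OF s] abs_Re_le_cmod[of s] by linarith
      have "norm (a (Suc n) * (exp (of_real (l n) * s) / s)) = norm (a (Suc n)) * (exp (2 * l n) / norm s)"
        using img[OF s] by (simp add: norm_mult norm_divide mult.commute)
      also have "\<dots> \<le> 1 * (exp (2 * l n) / 1)"
        using \<open>norm s \<ge> 1\<close> by (intro mult_mono a frac_le) auto
      also have "\<dots> = x ^ 2 * (1 / real (Suc n) ^ 2)"
        unfolding expl by simp
      finally show "norm (a (Suc n) * (exp (of_real (l n) * s) / s)) \<le> x ^ 2 * (1 / real (Suc n) ^ 2)" .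
    qed (intro summable_mult summable_inverse_squares)
    show "norm (vector_derivative L (at t)) \<le> norm (Complex 2 T - Complex 2 (-T))" for t
      by (simp add: L_def)
    show "\<forall>\<^sub>F M in sequentially. (\<lambda>s. \<Sum>n<M. a (Suc n) * (exp (of_real (l n) * s) / s)) contour_integrable_on L"
      using contour_integrable_lmul[OF int] by (intro always_eventually allI contour_integrable_sum) auto
    show "valid_path L"
      by (simp add: L_def)
  qed simp
  have "(\<lambda>s. \<Sum>n. a (Suc n) * (exp (of_real (l n) * s) / s)) s = G s * exp (of_real (ln x) * s) / s"
    if "s \<in> path_image L" for s
  proof -
    have "(\<lambda>n. a (Suc n) * of_nat (Suc n) powr (- s) * (exp (of_real (ln x) * s) / s))
         sums (G s * (exp (of_real (ln x) * s) / s))"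
      using img[OF that] by (intro sums_mult2 G)
    then have "(\<lambda>n. a (Suc n) * (exp (of_real (l n) * s) / s)) sums (G s * (exp (of_real (ln x) * s) / s))"
      using term_eq by (simp only: times_divide_eq_right)
    then show ?thesis
      by (simp add: sums_iff)
  qed
  then have eqG: "contour_integral L (\<lambda>s. \<Sum>n. a (Suc n) * (exp (of_real (l n) * s) / s))
      = contour_integral L (\<lambda>s. G s * exp (of_real (ln x) * s) / s)"
    by (intro contour_integral_cong refl) auto
  have "contour_integral L (\<lambda>s. \<Sum>n<M. a (Suc n) * (exp (of_real (l n) * s) / s)) = (\<Sum>n<M. a (Suc n) * J n)" for M
    unfolding J_def using contour_integrable_lmul[OF int] contour_integral_lmul[OF int]
    by (subst contour_integral_sum) (simp_all only: finite_lessThan)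
  with lim eqG have "(\<lambda>n. a (Suc n) * J n) sums contour_integral L (\<lambda>s. G s * exp (of_real (ln x) * s) / s)"
    by (simp add: sums_def)
  moreover have "(\<lambda>n. a (Suc n) * d n) sums (2 * pi * \<i> * (\<Sum>n=1..N. a n))"
  proof -
    have "(\<lambda>n. a (Suc n) * d n) sums (\<Sum>n<N. a (Suc n) * d n)"
      by (rule sums_finite) (auto simp: d_def)
    also have "(\<Sum>n<N. a (Suc n) * d n) = (\<Sum>n<N. 2 * pi * \<i> * a (Suc n))"
      by (intro sum.cong) (auto simp: d_def)
    also have "\<dots> = 2 * pi * \<i> * (\<Sum>n=1..N. a n)"
      unfolding sum_distrib_left [symmetric] by (simp add: sum.atLeast1_atMost_eq)
    finally show ?thesis .
  qed
  ultimately have sums: "(\<lambda>n. a (Suc n) * (J n - d n)) sums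
      (contour_integral L (\<lambda>s. G s * exp (of_real (ln x) * s) / s) - 2 * pi * \<i> * (\<Sum>n=1..N. a n))"
    by (simp only: right_diff_distrib sums_diff)
  have bd: "norm (a (Suc n) * (J n - d n)) \<le> 48 * x ^ 3 / T * (1 / real (Suc n) ^ 2)" for n
    using mult_mono[OF a[of "Suc n"] Jd[of n]] by (simp add: norm_mult)
  have "norm (\<Sum>n. a (Suc n) * (J n - d n)) \<le> (\<Sum>n. 48 * x ^ 3 / T * (1 / real (Suc n) ^ 2))"
    by (rule norm_suminf_le[OF bd summable_mult[OF summable_inverse_squares]])
  also have "\<dots> = 48 * x ^ 3 / T * zeta2"
    unfolding zeta2_def by (rule suminf_mult[OF summable_inverse_squares])
  finally show ?thesis
    using sums by (simp add: sums_iff L_def mult_ac)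
qed


lemma zeta2_nonneg: "zeta2 \<ge> 0"
  unfolding zeta2_def by (intro suminf_nonneg summable_inverse_squares) auto

lemma arsinh_le_powr:
  fixes T \<epsilon> :: real
  assumes "T \<ge> 0" "\<epsilon> > 0"
  shows "arsinh (2 * T) \<le> 4 powr \<epsilon> / \<epsilon> * (1 + T) powr \<epsilon>"
proof -
  have "sqrt ((2 * T)\<^sup>2 + 1) \<le> 2 * T + 1"
    using assms by (intro real_le_lsqrt) (auto simp: power2_eq_square algebra_simps)
  then have "arsinh (2 * T) \<le> ln (4 * (1 + T))"
    unfolding arsinh_real_def using assms
    using arsinh_real_aux[of "2 * T"] by (subst ln_le_cancel_iff) auto
  also have "\<dots> \<le> (4 * (1 + T)) powr \<epsilon> / \<epsilon>"
    using assms by (intro ln_powr_bound) auto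
  also have "\<dots> = 4 powr \<epsilon> / \<epsilon> * (1 + T) powr \<epsilon>"
    using assms by (subst powr_mult) auto
  finally show ?thesis .
qed

text \<open>Between the two vertical lines the integrand has no pole, as \<open>G\<close> is
  holomorphic there and 0 lies to the left of \<open>\<sigma>\<close>. The shift costs only the
  horizontal sides, short and with \<open>norm s \<ge> T\<close>, and the new vertical side.\<close>

lemma perron_shifted:
  fixes a :: "nat \<Rightarrow> complex" and G :: "complex \<Rightarrow> complex" and N :: nat and C \<sigma> \<epsilon> T :: real
  assumes a: "\<And>n. norm (a n) \<le> 1"
    and hol: "G holomorphic_on {s. Re s > 1 / 2}"
    and G: "\<And>s. Re s > 1 \<Longrightarrow> (\<lambda>n. a (Suc n) * of_nat (Suc n) powr (- s)) sums G s"
    and \<sigma>: "1 / 2 < \<sigma>" "\<sigma> < 2" and \<epsilon>: "\<epsilon> > 0"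
    and C: "\<And>s. \<sigma> \<le> Re s \<Longrightarrow> Re s \<le> 2 \<Longrightarrow> norm (G s) \<le> C * (1 + \<bar>Im s\<bar>) powr \<epsilon>"
    and N: "N \<ge> 1" and T: "T \<ge> 2"
  defines "x \<equiv> real N + 1 / 2"
  shows "2 * pi * norm (\<Sum>n=1..N. a n) \<le> 48 * zeta2 * x ^ 3 / T
      + 4 * (C * (1 + T) powr \<epsilon> * x ^ 2 / T) + 2 * (C * (1 + T) powr \<epsilon> * x powr \<sigma>) * arsinh (2 * T)"
proof -
  let ?g = "\<lambda>s. G s * exp (of_real (ln x) * s)"
  let ?h = "\<lambda>s. ?g s / s"
  let ?H = "{s. Re s > 1 / 2}"
  let ?I = "\<lambda>u v. contour_integral (linepath u v) ?h"
  let ?P = "rectpath (Complex \<sigma> (-T)) (Complex 2 T)"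
  have x: "x > 1" using N by (simp add: x_def)
  have C0: "C \<ge> 0"
    using order_trans[OF norm_ge_zero C[of 2]] \<sigma> by simp
  have hg: "?g holomorphic_on ?H"
    by (intro holomorphic_intros hol)
  have hh: "?h holomorphic_on ?H"
    by (intro holomorphic_intros hol) auto
  have sub: "path_image ?P \<subseteq> ?H"
    using path_image_rectpath_subset_cbox[of "Complex \<sigma> (-T)" "Complex 2 T"] T \<sigma>
    by (auto simp: in_cbox_complex_iff)
  have "(?h has_contour_integral 0) ?P"
    using sub by (intro Cauchy_theorem_convex_simple[OF hh convex_halfspace_Re_gt]) simp_all
  then have "contour_integral ?P ?h = 0"
    by (rule contour_integral_unique)
  moreover have "continuous_on (path_image ?P) ?h"
    using holomorphic_on_imp_continuous_on[OF hh] sub by (rule continuous_on_subset)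
  ultimately have "?I (Complex \<sigma> (-T)) (Complex 2 (-T)) + ?I (Complex 2 (-T)) (Complex 2 T)
       + ?I (Complex 2 T) (Complex \<sigma> T) + ?I (Complex \<sigma> T) (Complex \<sigma> (-T)) = 0"
    using contour_integral_rectpath_split[of "Complex \<sigma> (-T)" "Complex 2 T" ?h] by simp
  then have right: "?I (Complex 2 (-T)) (Complex 2 T) = - (?I (Complex \<sigma> (-T)) (Complex 2 (-T))
       + ?I (Complex 2 T) (Complex \<sigma> T) + ?I (Complex \<sigma> T) (Complex \<sigma> (-T)))" (is "?r = - (?a + ?b + ?c)")
    by (simp add: algebra_simps add_eq_0_iff)
  have expx: "exp (ln x * t) = x powr t" for t
    using x by (simp add: powr_def mult.commute)
  have bG: "norm (G s) \<le> C * (1 + T) powr \<epsilon>" if "\<sigma> \<le> Re s" "Re s \<le> 2" "\<bar>Im s\<bar> \<le> T" for s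
  proof -
    have "norm (G s) \<le> C * (1 + \<bar>Im s\<bar>) powr \<epsilon>"
      using that by (intro C)
    also have "\<dots> \<le> C * (1 + T) powr \<epsilon>"
      using that \<epsilon> by (intro mult_left_mono C0 powr_mono2) auto
    finally show ?thesis .
  qed
  have hor: "norm (?I u v) \<le> 2 * (C * (1 + T) powr \<epsilon> * x ^ 2 / T)"
    if uv: "Im u = Im v" "\<bar>Im v\<bar> = T" "closed_segment (Re u) (Re v) = {\<sigma>..2}" "norm (v - u) \<le> 2" for u v
  proof -
    have seg: "\<sigma> \<le> Re s \<and> Re s \<le> 2 \<and> Im s = Im v" if "s \<in> closed_segment u v" for s
      using that uv by (simp add: closed_segment_same_Im)
    have "?h contour_integrable_on linepath u v"
      by (intro contour_integrable_continuous_linepath continuous_on_subset[OF holomorphic_on_imp_continuous_on[OF hh]])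
         (use seg \<sigma> in force)
    moreover have "norm (?h s) \<le> C * (1 + T) powr \<epsilon> * x ^ 2 / T" if s: "s \<in> closed_segment u v" for s
    proof -
      have "norm (?h s) = norm (G s) * x powr Re s / norm s"
        by (simp add: norm_mult norm_divide expx)
      also have "\<dots> \<le> C * (1 + T) powr \<epsilon> * x powr 2 / T"
        using seg[OF s] uv T x C0 by (intro frac_le mult_mono bG powr_mono le_norm_complex_Im) auto
      finally show ?thesis using x by simp
    qed
    ultimately have "norm (?I u v) \<le> C * (1 + T) powr \<epsilon> * x ^ 2 / T * norm (v - u)"
      using C0 T by (intro contour_integral_bound_linepath) auto
    also have "\<dots> \<le> C * (1 + T) powr \<epsilon> * x ^ 2 / T * 2"
      using C0 T uv by (intro mult_left_mono) auto
    finally show ?thesis by (simp only: mult.commute[of 2])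
  qed
  have a: "norm ?a \<le> 2 * (C * (1 + T) powr \<epsilon> * x ^ 2 / T)"
    using T \<sigma> by (intro hor) (auto simp: closed_segment_eq_real_ivl complex_diff cmod_Complex_0)
  have b: "norm ?b \<le> 2 * (C * (1 + T) powr \<epsilon> * x ^ 2 / T)"
    using T \<sigma> by (intro hor) (auto simp: closed_segment_eq_real_ivl complex_diff cmod_Complex_0)
  have seg: "Re s = \<sigma> \<and> \<bar>Im s\<bar> \<le> T" if "s \<in> closed_segment (Complex \<sigma> T) (Complex \<sigma> (- T))" for s
    using that T by (auto simp: closed_segment_same_Re closed_segment_eq_real_ivl split: if_splits)
  have c: "norm ?c \<le> 2 * (C * (1 + T) powr \<epsilon> * x powr \<sigma>) * arsinh (2 * T)"
  proof (rule norm_contour_integral_vertical_over_id)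
    show "continuous_on (closed_segment (Complex \<sigma> T) (Complex \<sigma> (- T))) ?g"
      by (intro continuous_on_subset[OF holomorphic_on_imp_continuous_on[OF hg]])
         (use seg \<sigma> in force)
    fix s assume "s \<in> closed_segment (Complex \<sigma> T) (Complex \<sigma> (- T))"
    then have "Re s = \<sigma>" "\<bar>Im s\<bar> \<le> T"
      using seg by auto
    then show "norm (?g s) \<le> C * (1 + T) powr \<epsilon> * x powr \<sigma>"
      using \<sigma> by (auto simp: norm_mult expx intro!: mult_right_mono bG)
  qed (use T \<sigma> in auto)
  have tp: "norm (?r - 2 * pi * \<i> * (\<Sum>n=1..N. a n)) \<le> 48 * zeta2 * x ^ 3 / T"
    unfolding x_def by (rule truncated_perron) (use assms(1) G N T in auto)
  have "2 * pi * norm (\<Sum>n=1..N. a n) = norm (2 * pi * \<i> * (\<Sum>n=1..N. a n))"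
    by (simp add: norm_mult)
  also have "\<dots> \<le> norm (?r - 2 * pi * \<i> * (\<Sum>n=1..N. a n)) + norm ?r"
    by (subst norm_minus_commute, subst add.commute, rule norm_triangle_sub)
  also have "norm ?r = norm (?a + ?b + ?c)"
    unfolding right by (rule norm_minus_cancel)
  also have "\<dots> \<le> norm ?a + norm ?b + norm ?c"
    by (intro order_trans[OF norm_triangle_ineq] add_mono norm_triangle_ineq order_refl)
  finally show ?thesis
    using a b c tp by linarith
qed

theorem sum_bound_of_dirichlet_series_growth:
  fixes a :: "nat \<Rightarrow> complex" and G :: "complex \<Rightarrow> complex" and \<eta> :: real
  assumes a: "\<And>n. norm (a n) \<le> 1"
    and hol: "G holomorphic_on {s. Re s > 1 / 2}"
    and G: "\<And>s. Re s > 1 \<Longrightarrow> (\<lambda>n. a (Suc n) * of_nat (Suc n) powr (- s)) sums G s"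
    and growth: "\<And>\<sigma> \<epsilon>. \<sigma> > 1 / 2 \<Longrightarrow> \<epsilon> > 0 \<Longrightarrow>
      \<exists>C. \<forall>s. \<sigma> \<le> Re s \<longrightarrow> Re s \<le> 2 \<longrightarrow> norm (G s) \<le> C * (1 + \<bar>Im s\<bar>) powr \<epsilon>"
    and \<eta>: "\<eta> > 0"
  shows "\<exists>C. \<forall>N. norm (\<Sum>n=1..N. a n) \<le> C * real N powr (1 / 2 + \<eta>)"
proof -
  \<comment> \<open>With \<open>T\<close> of order \<open>x ^ 3\<close> the factor
    \<open>(1 + T) powr (2 * \<epsilon>)\<close> costs \<open>x powr (6 * \<epsilon>)\<close>, which
    uses half of \<open>\<eta>\<close>; the other half goes into \<open>\<sigma>\<close>. The cap by
    1 keeps \<open>\<sigma> < 2\<close>.\<close>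
  define \<sigma> where "\<sigma> = 1 / 2 + min (\<eta> / 2) 1"
  define \<epsilon> where "\<epsilon> = \<eta> / 12"
  have \<sigma>: "1 / 2 < \<sigma>" "\<sigma> < 2" "\<sigma> + 6 * \<epsilon> \<le> 1 / 2 + \<eta>" and \<epsilon>: "\<epsilon> > 0"
    using \<eta> by (auto simp: \<sigma>_def \<epsilon>_def)
  obtain C where C: "\<And>s. \<sigma> \<le> Re s \<Longrightarrow> Re s \<le> 2 \<Longrightarrow> norm (G s) \<le> C * (1 + \<bar>Im s\<bar>) powr \<epsilon>"
    using growth[OF \<sigma>(1) \<epsilon>] by blast
  have C0: "C \<ge> 0"
    using order_trans[OF norm_ge_zero C[of 2]] \<sigma> by simp
  \<comment> \<open>The summands belong to the Perron error, the horizontal sides and the vertical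
    side, each enlarged to a multiple of the common factor
    \<open>(1 + T) powr (2 * \<epsilon>) * x powr \<sigma>\<close>.\<close>
  define K where "K = 24 * zeta2 + 4 * C + 2 * C * (4 powr \<epsilon> / \<epsilon>)"
  have K0: "K \<ge> 0"
    unfolding K_def using zeta2_nonneg C0 \<epsilon> by simp
  have "norm (\<Sum>n=1..N. a n) \<le> (K * 4 powr (2 * \<epsilon>) * 2 powr (1 / 2 + \<eta>)) * real N powr (1 / 2 + \<eta>)" for N
  proof (cases "N \<ge> 1")
    case N: True
    define x where "x = real N + 1 / 2"
    \<comment> \<open>This choice makes the Perron error a constant.\<close>
    define T where "T = 2 * x ^ 3"
    have x: "x > 1" "x \<le> 2 * real N" using N by (auto simp: x_def)
    have x3: "x ^ 3 > 1" using x by simp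
    then have T: "T \<ge> 2" by (simp add: T_def)
    have p1: "(1 + T) powr \<epsilon> \<ge> 1"
      using T \<epsilon> by (intro ge_one_powr_ge_zero) auto
    have p2: "x powr \<sigma> \<ge> 1"
      using x \<sigma> by (intro ge_one_powr_ge_zero) auto
    have p11: "1 \<le> (1 + T) powr \<epsilon> * (1 + T) powr \<epsilon>"
      using mult_mono[OF p1 p1] by simp
    have p3: "x ^ 2 / T \<le> 1"
      using x by (simp add: T_def power2_eq_square power3_eq_cube)
    have "norm (\<Sum>n=1..N. a n) \<le> 2 * pi * norm (\<Sum>n=1..N. a n)"
      using pi_gt3 mult_right_mono[of 1 "2 * pi" "norm (\<Sum>n=1..N. a n)"] by simp
    also have "\<dots> \<le> 48 * zeta2 * x ^ 3 / T
      + 4 * (C * (1 + T) powr \<epsilon> * x ^ 2 / T) + 2 * (C * (1 + T) powr \<epsilon> * x powr \<sigma>) * arsinh (2 * T)"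
      unfolding x_def by (rule perron_shifted[OF a hol G \<sigma>(1,2) \<epsilon> C N T])
    also have "48 * zeta2 * x ^ 3 / T = 24 * zeta2"
      using x by (simp add: T_def)
    also have "24 * zeta2 \<le> 24 * zeta2 * ((1 + T) powr \<epsilon> * (1 + T) powr \<epsilon> * x powr \<sigma>)"
      using mult_left_mono[OF mult_mono[OF p11 p2], of "24 * zeta2"] zeta2_nonneg by simp
    also have "C * (1 + T) powr \<epsilon> * x ^ 2 / T = C * ((1 + T) powr \<epsilon> * 1 * (x ^ 2 / T))"
      by simp
    also have "\<dots> \<le> C * ((1 + T) powr \<epsilon> * (1 + T) powr \<epsilon> * x powr \<sigma>)"
      using p1 order_trans[OF p3 p2] C0 T by (intro mult_left_mono mult_mono) (auto simp del: divide_le_eq_1_pos divide_le_eq_1)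
    also have "2 * (C * (1 + T) powr \<epsilon> * x powr \<sigma>) * arsinh (2 * T)
      \<le> 2 * (C * (1 + T) powr \<epsilon> * x powr \<sigma>) * (4 powr \<epsilon> / \<epsilon> * (1 + T) powr \<epsilon>)"
      using C0 T \<epsilon> by (intro mult_left_mono arsinh_le_powr) auto
    also have "24 * zeta2 * ((1 + T) powr \<epsilon> * (1 + T) powr \<epsilon> * x powr \<sigma>)
        + 4 * (C * ((1 + T) powr \<epsilon> * (1 + T) powr \<epsilon> * x powr \<sigma>))
        + 2 * (C * (1 + T) powr \<epsilon> * x powr \<sigma>) * (4 powr \<epsilon> / \<epsilon> * (1 + T) powr \<epsilon>)
      = K * ((1 + T) powr (2 * \<epsilon>) * x powr \<sigma>)"
      unfolding K_def mult_2[of \<epsilon>] powr_add by (simp add: algebra_simps)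
    finally have 1: "norm (\<Sum>n=1..N. a n) \<le> K * ((1 + T) powr (2 * \<epsilon>) * x powr \<sigma>)"
      by simp
    have "(1 + T) powr (2 * \<epsilon>) \<le> (4 * x ^ 3) powr (2 * \<epsilon>)"
      using x3 \<epsilon> T by (intro powr_mono2) (auto simp: T_def)
    also have "\<dots> = 4 powr (2 * \<epsilon>) * x powr (6 * \<epsilon>)"
    proof -
      have "x ^ 3 = x powr 3"
        using x by simp
      then show ?thesis
        using x by (simp only: powr_mult powr_powr) simp
    qed
    finally have "K * ((1 + T) powr (2 * \<epsilon>) * x powr \<sigma>) \<le> K * (4 powr (2 * \<epsilon>) * x powr (6 * \<epsilon>) * x powr \<sigma>)"
      using K0 by (intro mult_left_mono mult_right_mono) auto
    also have "\<dots> = K * (4 powr (2 * \<epsilon>) * x powr (\<sigma> + 6 * \<epsilon>))"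
      by (simp add: powr_add)
    also have "\<dots> \<le> K * (4 powr (2 * \<epsilon>) * x powr (1 / 2 + \<eta>))"
      using \<sigma> x K0 by (intro mult_left_mono powr_mono) auto
    also have "\<dots> \<le> K * (4 powr (2 * \<epsilon>) * (2 * real N) powr (1 / 2 + \<eta>))"
      using \<eta> x K0 by (intro mult_left_mono powr_mono2) auto
    also have "\<dots> = (K * 4 powr (2 * \<epsilon>) * 2 powr (1 / 2 + \<eta>)) * real N powr (1 / 2 + \<eta>)"
      by (simp add: powr_mult)
    finally show ?thesis using 1 by linarith
  qed (use K0 in auto)
  then show ?thesis by blast
qed

section \<open>Growth of the reciprocal of a zero-free function\<close>

text \<open>After rescaling to the unit disc, \<open>w / (2 * A - w)\<close> maps the half-plane
  \<open>Re w < A\<close> into the unit disc and fixes 0, because such \<open>w\<close> are nearer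
  to 0 than to \<open>2 * A\<close>. The Schwarz lemma applies to the composite, and solving for the
  value of \<open>f\<close> gives the bound.\<close>

lemma borel_caratheodory:
  fixes f :: "complex \<Rightarrow> complex" and A R :: real
  assumes hol: "f holomorphic_on ball c R" and "f c = 0" and R: "R > 0"
    and less: "\<And>z. z \<in> ball c R \<Longrightarrow> Re (f z) < A"
    and z: "norm (z - c) \<le> r" and r: "r < R"
  shows "norm (f z) \<le> 2 * A * r / (R - r)"
proof -
  define F where "F = (\<lambda>w. f (c + of_real R * w))"
  define \<phi> where "\<phi> = (\<lambda>w. F w / (2 * of_real A - F w))"
  define w where "w = (z - c) / of_real R"
  have A: "A > 0"
    using less[of c] R assms(2) by simp
  have ball: "c + of_real R * w \<in> ball c R" if "w \<in> ball 0 1" for w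
    using that R by (simp add: dist_norm norm_mult)
  have ReF: "Re (F w) < A" if "w \<in> ball 0 1" for w
    unfolding F_def by (rule less[OF ball[OF that]])
  have nz: "2 * of_real A - F w \<noteq> 0" if "w \<in> ball 0 1" for w
    using ReF[OF that] A by (auto simp: complex_eq_iff)
  have holF: "F holomorphic_on ball 0 1"
  proof -
    have "f \<circ> (\<lambda>w. c + of_real R * w) holomorphic_on ball 0 1"
      using ball by (intro holomorphic_on_compose_gen[OF _ hol] holomorphic_intros) auto
    then show ?thesis by (simp add: F_def o_def)
  qed
  have wn: "norm w < 1" "norm w \<le> r / R"
    using z r R by (auto simp: w_def norm_divide divide_right_mono)
  have "norm (\<phi> w) \<le> norm w"
  proof (rule Schwarz_Lemma(1))
    show "\<phi> holomorphic_on ball 0 1"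
      unfolding \<phi>_def using nz by (intro holomorphic_intros holF) auto
    show "\<phi> 0 = 0"
      using assms(2) by (simp add: \<phi>_def F_def)
    show "norm (\<phi> v) < 1" if "norm v < 1" for v
    proof -
      have v: "v \<in> ball 0 1" using that by simp
      have "A * Re (F v) < A * A"
        using ReF[OF v] A by simp
      then have "norm (F v) ^ 2 < norm (2 * of_real A - F v) ^ 2"
        unfolding cmod_power2 by (simp add: power2_eq_square algebra_simps)
      then have "norm (F v) < norm (2 * of_real A - F v)"
        by (rule power2_less_imp_less) simp
      then show ?thesis
        unfolding \<phi>_def norm_divide by (intro divide_less_eq_1_pos[THEN iffD2]) (auto intro: le_less_trans[OF norm_ge_zero])
    qed
  qed (rule wn)
  then have "norm (F w) \<le> norm w * norm (2 * of_real A - F w)"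
    using nz[of w] wn by (simp add: \<phi>_def norm_divide divide_le_eq)
  also have "\<dots> \<le> r / R * (2 * A + norm (F w))"
    using wn A norm_triangle_ineq4[of "2 * of_real A" "F w"] order_trans[OF norm_ge_zero wn(2)]
    by (intro mult_mono) auto
  finally have "norm (F w) * (R - r) \<le> 2 * A * r"
    using R by (simp add: field_simps)
  moreover have "F w = f z"
    using R by (simp add: F_def w_def)
  ultimately show ?thesis
    using r by (simp add: field_simps)
qed

text \<open>
  A soft form of Hadamard's three circles theorem: the first Taylor coefficients are controlled
  by the small disc, the tail by the large one.
\<close>

lemma two_disc_bound:
  fixes r \<rho> R \<epsilon> :: real
  assumes "0 < r" "0 \<le> \<rho>" "\<rho> < R" "\<epsilon> > 0"
  shows "\<exists>K\<ge>0. \<forall>f c R' A B z. R < R' \<longrightarrow> r < R' \<longrightarrow> f holomorphic_on ball c R' \<longrightarrow>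
     (\<forall>z\<in>cball c R. norm (f z) \<le> A) \<longrightarrow> (\<forall>z\<in>cball c r. norm (f z) \<le> B) \<longrightarrow>
     norm (z - c) \<le> \<rho> \<longrightarrow> norm (f z :: complex) \<le> \<epsilon> * A + K * B"
proof -
  define q where "q = \<rho> / R"
  have q: "0 \<le> q" "q < 1" using assms by (auto simp: q_def)
  have "(\<lambda>n. q ^ n / (1 - q)) \<longlonglongrightarrow> 0 / (1 - q)"
    using q by (intro tendsto_intros LIMSEQ_power_zero) auto
  then have "\<forall>\<^sub>F n in sequentially. q ^ n / (1 - q) < \<epsilon>"
    using assms(4) by (intro order_tendstoD) auto
  \<comment> \<open>\<open>M\<close> and \<open>K\<close> are fixed from the radii and
    \<open>\<epsilon>\<close> alone, before \<open>f\<close> and \<open>c\<close> appear: the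
    application needs one constant for discs at all heights.\<close>
  then obtain M where M: "q ^ M / (1 - q) < \<epsilon>"
    by (auto simp: eventually_sequentially)
  define K where "K = (\<Sum>n<M. (\<rho> / r) ^ n)"
  have "norm (f z) \<le> \<epsilon> * A + K * B"
    if R': "R < R'" "r < R'" and hol: "f holomorphic_on ball c R'"
      and A: "\<And>z. z \<in> cball c R \<Longrightarrow> norm (f z) \<le> A" and B: "\<And>z. z \<in> cball c r \<Longrightarrow> norm (f z) \<le> B"
      and z: "norm (z - c) \<le> \<rho>" for f :: "complex \<Rightarrow> complex" and c R' A B z
  proof -
    define b where "b = (\<lambda>n. (deriv ^^ n) f c / fact n)"
    have A0: "A \<ge> 0"
      using order_trans[OF norm_ge_zero A[of c]] assms by simp
    have bA: "norm (b n) \<le> C / t ^ n" if "0 < t" "t < R'" "\<And>z. z \<in> cball c t \<Longrightarrow> norm (f z) \<le> C" for n C t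
    proof -
      have "norm ((deriv ^^ n) f c) \<le> fact n * C / t ^ n"
      proof (rule Cauchy_inequality)
        show "f holomorphic_on ball c t"
          by (rule holomorphic_on_subset[OF hol]) (use that in auto)
        show "continuous_on (cball c t) f"
          by (rule continuous_on_subset[OF holomorphic_on_imp_continuous_on[OF hol]]) (use that in auto)
      qed (use that in \<open>auto simp: dist_norm\<close>)
      then show ?thesis by (simp add: b_def norm_divide field_simps)
    qed
    have "(\<lambda>n. b n * (z - c) ^ n) sums f z"
      unfolding b_def by (rule holomorphic_power_series[OF hol]) (use z assms R' in \<open>auto simp: dist_norm norm_minus_commute\<close>)
    then have fz: "f z = (\<Sum>n. b n * (z - c) ^ n)" and sm: "summable (\<lambda>n. b n * (z - c) ^ n)"
      by (auto simp: sums_iff)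
    have t1: "norm (b n * (z - c) ^ n) \<le> A * q ^ n" for n
    proof -
      have "norm (b n * (z - c) ^ n) \<le> A / R ^ n * \<rho> ^ n"
        unfolding norm_mult norm_power using assms R' A z A0
        by (intro mult_mono bA power_mono) auto
      then show ?thesis by (simp add: q_def power_divide)
    qed
    have t2: "norm (b n * (z - c) ^ n) \<le> B * (\<rho> / r) ^ n" for n
    proof -
      have "norm (b n * (z - c) ^ n) \<le> B / r ^ n * \<rho> ^ n"
        unfolding norm_mult norm_power using assms R' B z order_trans[OF norm_ge_zero B[of c]]
        by (intro mult_mono bA power_mono) auto
      then show ?thesis by (simp add: power_divide)
    qed
    have t1': "norm (b (n + M) * (z - c) ^ (n + M)) \<le> A * q ^ M * q ^ n" for n
      using t1[of "n + M"] by (simp add: power_add mult_ac)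
    have sq: "summable (\<lambda>n. A * q ^ M * q ^ n)"
      using q by (intro summable_mult summable_geometric) auto
    have "f z = (\<Sum>n. b (n + M) * (z - c) ^ (n + M)) + (\<Sum>n<M. b n * (z - c) ^ n)"
      unfolding fz by (rule suminf_split_initial_segment[OF sm])
    also have "norm \<dots> \<le> (\<Sum>n. A * q ^ M * q ^ n) + (\<Sum>n<M. B * (\<rho> / r) ^ n)"
      by (intro order_trans[OF norm_triangle_ineq] add_mono norm_suminf_le[OF t1' sq]
         order_trans[OF norm_sum sum_mono] t2)
    also have "(\<Sum>n<M. B * (\<rho> / r) ^ n) = K * B"
      by (simp add: K_def sum_distrib_left mult.commute)
    also have "(\<Sum>n. A * q ^ M * q ^ n) = A * (q ^ M / (1 - q))"
      using q by (subst suminf_mult) (auto simp: suminf_geometric summable_geometric)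
    also have "\<dots> \<le> A * \<epsilon>"
      using M A0 by (intro mult_left_mono) auto
    finally show ?thesis by (simp add: mult.commute)
  qed
  moreover have "K \<ge> 0"
    unfolding K_def using assms by (intro sum_nonneg) auto
  ultimately show ?thesis by blast
qed

text \<open>Borel--Caratheodory alone would give some fixed power of t. But \<open>L\<close> and its
  reciprocal are both bounded near the centre \<open>c\<close>, so the logarithm relative to
  \<open>c\<close> is bounded there, and \<open>two_disc_bound\<close> shrinks the coefficient of
  the logarithmic bound as far as desired at the price of an additive constant.\<close>

lemma reciprocal_growth:
  fixes L G :: "complex \<Rightarrow> complex" and B \<sigma> \<epsilon> :: real
  assumes holL: "L holomorphic_on {s. Re s > 1 / 2} - {1}"
    and nz: "\<And>s. Re s > 1 / 2 \<Longrightarrow> s \<noteq> 1 \<Longrightarrow> L s \<noteq> 0"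
    and growth: "\<And>\<sigma>. \<sigma> > 1 / 2 \<Longrightarrow>
      \<exists>C. \<forall>s. \<sigma> \<le> Re s \<longrightarrow> 1 \<le> \<bar>Im s\<bar> \<longrightarrow> norm (L s) \<le> C * (1 + norm s) ^ 2"
    and B: "\<And>s. Re s \<ge> 3 / 2 \<Longrightarrow> norm (L s) \<le> B"
    and B': "\<And>s. Re s \<ge> 3 / 2 \<Longrightarrow> norm (inverse (L s)) \<le> B"
    and holG: "G holomorphic_on {s. Re s > 1 / 2}"
    and G: "\<And>s. Re s > 1 / 2 \<Longrightarrow> s \<noteq> 1 \<Longrightarrow> G s = inverse (L s)"
    and \<sigma>: "\<sigma> > 1 / 2" and \<epsilon>: "\<epsilon> > 0"
  shows "\<exists>C. \<forall>s. \<sigma> \<le> Re s \<longrightarrow> Re s \<le> 2 \<longrightarrow> norm (G s) \<le> C * (1 + \<bar>Im s\<bar>) powr \<epsilon>"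
proof -
  define \<delta> where "\<delta> = min (\<sigma> - 1 / 2) (1 / 2)"
  have \<delta>: "0 < \<delta>" "\<delta> \<le> 1 / 2" "1 / 2 + \<delta> \<le> \<sigma>" using \<sigma> by (auto simp: \<delta>_def min_def)
  \<comment> \<open>Nested radii around a centre with real part 2: \<open>\<rho>\<close> reaches the
    line \<open>Re s = \<sigma>\<close>, \<open>R\<close> carries the bound on the modulus of the
    logarithm, \<open>R2\<close> the one on its real part, and at 3/2 the disc would touch the
    critical line.\<close>
  define \<rho> R R2 where "\<rho> = 3 / 2 - \<delta>" and "R = 3 / 2 - \<delta> / 2" and "R2 = 3 / 2 - \<delta> / 4"
  have rad: "0 \<le> \<rho>" "\<rho> < R" "R < R2" "R2 < 3 / 2" "0 < R2" using \<delta> by (auto simp: \<rho>_def R_def R2_def)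
  obtain C0 where C0: "\<And>s. 1 / 2 + \<delta> / 4 \<le> Re s \<Longrightarrow> 1 \<le> \<bar>Im s\<bar> \<Longrightarrow> norm (L s) \<le> C0 * (1 + norm s) ^ 2"
    using growth[of "1 / 2 + \<delta> / 4"] \<delta> by auto
  define C1 where "C1 = max C0 1"
  have C1: "norm (L s) \<le> C1 * (1 + norm s) ^ 2" if "1 / 2 + \<delta> / 4 \<le> Re s" "1 \<le> \<bar>Im s\<bar>" for s
    by (rule order_trans[OF C0[OF that]]) (auto simp: C1_def intro!: mult_right_mono)
  \<comment> \<open>The Borel--Caratheodory constant for passing from \<open>R2\<close> to
    \<open>R\<close>. Dividing by it in \<open>\<epsilon>'\<close> leaves
    \<open>\<epsilon> / 2\<close>, halved because \<open>X\<close> below is quadratic in the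
    height.\<close>
  define k where "k = 2 * R / (R2 - R)"
  have k: "k > 0" using rad by (simp add: k_def)
  define \<epsilon>' where "\<epsilon>' = \<epsilon> / (2 * k)"
  obtain K where K0: "K \<ge> 0" and K: "\<And>f c R' A B z. R < R' \<Longrightarrow> 1 / 4 < R' \<Longrightarrow> f holomorphic_on ball c R' \<Longrightarrow>
     (\<forall>z\<in>cball c R. norm (f z) \<le> A) \<Longrightarrow> (\<forall>z\<in>cball c (1 / 4). norm (f z) \<le> B) \<Longrightarrow>
     norm (z - c) \<le> \<rho> \<Longrightarrow> norm (f z :: complex) \<le> \<epsilon>' * A + K * B"
    using two_disc_bound[of "1 / 4" \<rho> R \<epsilon>'] rad k \<epsilon> unfolding \<epsilon>'_def by auto
  have Bpos: "B > 0"
  proof -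
    have "0 < norm (L 2)" using nz[of 2] by simp
    also have "\<dots> \<le> B" by (rule B) simp
    finally show ?thesis .
  qed
  define B2 where "B2 = ln (B * B) + 1"
  define D where "D = B * exp (K * (2 * B2)) * (exp 1 * (C1 * 36 * B)) powr (\<epsilon> / 2)"
  \<comment> \<open>Height 3 keeps the disc of radius 3/2 at imaginary parts above 3/2 in modulus,
    off the possible pole and inside the range of the growth hypothesis.\<close>
  have far: "norm (G s) \<le> D * (1 + \<bar>Im s\<bar>) powr \<epsilon>"
    if s: "\<sigma> \<le> Re s" "Re s \<le> 2" "\<bar>Im s\<bar> \<ge> 3" for s
  proof -
    define t where "t = \<bar>Im s\<bar>"
    define c where "c = Complex 2 (Im s)"
    let ?U = "ball c (3 / 2)"
    have Uim: "\<bar>Im z\<bar> > 3 / 2" "\<bar>Im z\<bar> < t + 3 / 2" and Ure: "Re z > 1 / 2" "Re z < 7 / 2" if "z \<in> ?U" for z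
      using that abs_Re_le_cmod[of "c - z"] abs_Im_le_cmod[of "c - z"] s(3)
      by (auto simp: c_def dist_norm t_def)
    have Usub: "?U \<subseteq> {s. Re s > 1 / 2} - {1}"
      using Uim Ure by fastforce
    have holU: "L holomorphic_on ?U"
      by (rule holomorphic_on_subset[OF holL Usub])
    have nzU: "L z \<noteq> 0" if "z \<in> ?U" for z
      using nz[of z] Usub that by blast
    obtain l where l: "l holomorphic_on ?U" and el: "\<And>z. z \<in> ?U \<Longrightarrow> exp (l z) = L z"
      using holomorphic_logarithm_exists[OF convex_ball open_ball holU nzU, of c] by auto
    define f where "f = (\<lambda>z. l z - l c)"
    have cU: "c \<in> ?U" by simp
    have ef: "exp (Re (f z)) = norm (L z) * norm (inverse (L c))" if "z \<in> ?U" for z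
    proof -
      have "exp (f z) = L z * inverse (L c)"
        unfolding f_def exp_diff using el[OF that] el[OF cU] by (simp add: divide_inverse)
      then show ?thesis
        by (metis norm_exp_eq_Re norm_mult)
    qed
    have invc: "norm (inverse (L c)) \<le> B"
      by (rule B') (simp add: c_def)
    have holf: "f holomorphic_on ?U"
      unfolding f_def by (intro holomorphic_intros l)
    define X where "X = C1 * (6 + t) ^ 2 * B"
    have X: "X > 0" using Bpos by (auto simp: X_def C1_def t_def intro!: mult_pos_pos)
    \<comment> \<open>The summand 1 makes the inequality strict, as
      \<open>borel_caratheodory\<close> demands; \<open>B2\<close> contains it for the same
      reason.\<close>
    have outer: "Re (f z) < ln X + 1" if z: "z \<in> ball c R2" for z
    proof -
      have zU: "z \<in> ?U" using z rad by auto
      have re: "Re z \<ge> 1 / 2 + \<delta> / 4"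
        using z abs_Re_le_cmod[of "c - z"] by (auto simp: c_def dist_norm R2_def)
      have "norm z \<le> \<bar>Re z\<bar> + \<bar>Im z\<bar>" by (rule cmod_le)
      also have "\<dots> \<le> 7 / 2 + (t + 3 / 2)"
        using Uim[OF zU] Ure[OF zU] by linarith
      finally have nz: "1 + norm z \<le> 6 + t" by simp
      have "exp (Re (f z)) = norm (L z) * norm (inverse (L c))"
        by (rule ef[OF zU])
      also have "\<dots> \<le> C1 * (1 + norm z) ^ 2 * B"
        using re Uim[OF zU] by (intro mult_mono C1 invc) (auto simp: C1_def)
      also have "\<dots> \<le> X"
        unfolding X_def using nz Bpos by (intro mult_right_mono mult_left_mono power_mono) (auto simp: C1_def)
      finally have "Re (f z) \<le> ln X"
        using X by (simp add: ln_ge_iff)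
      then show ?thesis by simp
    qed
    have inner: "Re (f z) < B2" if z: "z \<in> ball c (1 / 2)" for z
    proof -
      have zU: "z \<in> ?U" using z by auto
      have re: "Re z \<ge> 3 / 2"
        using z abs_Re_le_cmod[of "c - z"] by (auto simp: c_def dist_norm)
      have "exp (Re (f z)) \<le> B * B"
        unfolding ef[OF zU] using Bpos by (intro mult_mono B invc re) auto
      then have "Re (f z) \<le> ln (B * B)"
        using Bpos by (simp add: ln_ge_iff)
      then show ?thesis by (simp add: B2_def)
    qed
    have f0: "f c = 0" by (simp add: f_def)
    have "norm (f s) \<le> \<epsilon>' * (k * (ln X + 1)) + K * (2 * B2)"
    proof (rule K[where f = f and c = c and R' = "3 / 2" and z = s])
      show "f holomorphic_on ball c (3 / 2)" by (rule holf)
      show "\<forall>z\<in>cball c R. norm (f z) \<le> k * (ln X + 1)"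
      proof
        fix z assume "z \<in> cball c R"
        then have "norm (f z) \<le> 2 * (ln X + 1) * R / (R2 - R)"
          using rad outer by (intro borel_caratheodory[of f c R2] holomorphic_on_subset[OF holf] f0)
            (auto simp: dist_norm norm_minus_commute)
        then show "norm (f z) \<le> k * (ln X + 1)" by (simp add: k_def mult_ac)
      qed
      show "\<forall>z\<in>cball c (1 / 4). norm (f z) \<le> 2 * B2"
      proof
        fix z assume "z \<in> cball c (1 / 4)"
        then have "norm (f z) \<le> 2 * B2 * (1 / 4) / (1 / 2 - 1 / 4)"
          using inner by (intro borel_caratheodory[of f c "1 / 2"] holomorphic_on_subset[OF holf] f0)
            (auto simp: dist_norm norm_minus_commute)
        then show "norm (f z) \<le> 2 * B2" by simp
      qed
      have "s - c = of_real (Re s - 2)"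
        by (simp add: complex_eq_iff c_def)
      then show "norm (s - c) \<le> \<rho>"
        using s \<delta> by (simp only: norm_of_real) (simp add: \<rho>_def)
    qed (use rad \<delta> in \<open>auto simp: R_def\<close>)
    also have "\<epsilon>' * (k * (ln X + 1)) = \<epsilon> / 2 * (ln X + 1)"
      using k by (simp add: \<epsilon>'_def)
    finally have fs: "norm (f s) \<le> \<epsilon> / 2 * (ln X + 1) + K * (2 * B2)" .
    have sU: "s \<in> ?U"
      using s \<sigma> by (auto simp: c_def dist_norm cmod_def)
    have "inverse (L s) = inverse (L c) * exp (- f s)"
      unfolding f_def using el[OF sU] el[OF cU] nzU[OF cU] by (simp add: exp_diff exp_minus field_simps)
    then have "norm (G s) = norm (inverse (L c)) * exp (- Re (f s))"
      using G[of s] subsetD[OF Usub sU] by (auto simp: norm_mult)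
    also have "\<dots> \<le> B * exp (\<epsilon> / 2 * (ln X + 1) + K * (2 * B2))"
      using fs invc Bpos abs_Re_le_cmod[of "f s"] by (intro mult_mono) auto
    also have "\<dots> = B * exp (K * (2 * B2)) * (exp 1 * X) powr (\<epsilon> / 2)"
      using X by (simp add: powr_def exp_add ln_mult algebra_simps)
    also have "\<dots> \<le> B * exp (K * (2 * B2)) * (exp 1 * (C1 * (6 * (1 + t)) ^ 2 * B)) powr (\<epsilon> / 2)"
      using Bpos \<epsilon> X unfolding X_def
      by (intro mult_left_mono powr_mono2 mult_right_mono power_mono) (auto simp: C1_def t_def)
    also have "exp 1 * (C1 * (6 * (1 + t)) ^ 2 * B) = exp 1 * (C1 * 36 * B) * (1 + t) powr 2"
      by (simp add: t_def power2_eq_square algebra_simps)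
    also have "(exp 1 * (C1 * 36 * B) * (1 + t) powr 2) powr (\<epsilon> / 2) =
        (exp 1 * (C1 * 36 * B)) powr (\<epsilon> / 2) * (1 + t) powr \<epsilon>"
      by (simp only: powr_mult powr_powr) (use Bpos in \<open>simp add: C1_def t_def\<close>)
    finally show ?thesis by (simp add: D_def t_def mult_ac)
  qed
  \<comment> \<open>At small heights continuity of \<open>G\<close> on a compact rectangle suffices,
    whether or not it contains the point 1.\<close>
  let ?Q = "cbox (Complex \<sigma> (-3)) (Complex 2 3)"
  have "compact (G ` ?Q)"
    by (intro compact_continuous_image continuous_on_subset[OF holomorphic_on_imp_continuous_on[OF holG]] compact_cbox)
       (use \<sigma> in \<open>auto simp: in_cbox_complex_iff\<close>)
  then obtain E where E: "\<And>s. s \<in> ?Q \<Longrightarrow> norm (G s) \<le> E"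
    using compact_imp_bounded bounded_iff by (metis imageI)
  have "norm (G s) \<le> max D (max E 0) * (1 + \<bar>Im s\<bar>) powr \<epsilon>" if s: "\<sigma> \<le> Re s" "Re s \<le> 2" for s
  proof (cases "\<bar>Im s\<bar> \<ge> 3")
    case True
    have "norm (G s) \<le> D * (1 + \<bar>Im s\<bar>) powr \<epsilon>"
      using s True by (rule far)
    also have "\<dots> \<le> max D (max E 0) * (1 + \<bar>Im s\<bar>) powr \<epsilon>"
      by (intro mult_right_mono) auto
    finally show ?thesis .
  next
    case False
    have "norm (G s) \<le> E"
      using s False by (intro E) (auto simp: in_cbox_complex_iff)
    also have "\<dots> \<le> max D (max E 0) * 1"
      by simp
    also have "\<dots> \<le> max D (max E 0) * (1 + \<bar>Im s\<bar>) powr \<epsilon>"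
      using \<epsilon> by (intro mult_left_mono ge_one_powr_ge_zero) auto
    finally show ?thesis .
  qed
  then show ?thesis by blast
qed

section \<open>The Moebius function\<close>

definition moebius_mu :: "nat \<Rightarrow> int" where
  "moebius_mu n = (if squarefree n then (-1) ^ card (prime_factors n) else 0)"

lemma abs_moebius_mu_le: "\<bar>moebius_mu n\<bar> \<le> 1"
  by (simp add: moebius_mu_def power_abs)

lemma moebius_1 [simp]: "moebius_mu (Suc 0) = 1"
  by (simp add: moebius_mu_def)

lemma moebius_prime_mult:
  assumes "prime p"
  shows "moebius_mu (p * d) = (if p dvd d then 0 else - moebius_mu d)"
proof (cases "p dvd d")
  case True
  then have "p ^ 2 dvd p * d"
    by (simp add: power2_eq_square)
  then have "\<not> squarefree (p * d)"
    using assms not_squarefreeI[of p "p * d"] by (auto simp: prime_nat_iff)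
  with True show ?thesis by (simp add: moebius_mu_def)
next
  case False
  then have "d \<noteq> 0" by (intro notI) simp
  have "coprime p d"
    using assms False by (simp add: prime_imp_coprime)
  then have "squarefree (p * d) \<longleftrightarrow> squarefree d"
    using squarefree_multD(2) squarefree_mult_coprime squarefree_prime[OF assms] by blast
  moreover have "prime_factors (p * d) = insert p (prime_factors d)"
    using assms \<open>d \<noteq> 0\<close> by (subst prime_factors_product) (auto simp: prime_prime_factors)
  moreover have "p \<notin> prime_factors d"
    using False by (auto simp: prime_factors_dvd)
  ultimately show ?thesis
    using False by (simp add: moebius_mu_def)
qed

text \<open>The involution \<open>d \<leftrightarrow> p * d\<close> cancels the sum.\<close>

lemma sum_moebius_eq_0:
  assumes "finite D" "prime p"
    and inv: "\<And>d. \<not> p dvd d \<Longrightarrow> p * d \<in> D \<longleftrightarrow> d \<in> D"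
  shows "(\<Sum>d\<in>D. moebius_mu d) = 0"
proof -
  define D0 where "D0 = {d \<in> D. \<not> p dvd d}"
  have fin: "finite D0" using assms(1) by (simp add: D0_def)
  have p: "p > 0" using assms(2) prime_gt_0_nat by blast
  have "(\<Sum>d\<in>D. moebius_mu d) = (\<Sum>d\<in>D0 \<union> (*) p ` D0. moebius_mu d)"
  proof (rule sum.mono_neutral_right)
    show "D0 \<union> (*) p ` D0 \<subseteq> D"
      using inv by (auto simp: D0_def)
    show "\<forall>d\<in>D - (D0 \<union> (*) p ` D0). moebius_mu d = 0"
    proof
      fix d assume d: "d \<in> D - (D0 \<union> (*) p ` D0)"
      then obtain e where e: "d = p * e" by (auto simp: D0_def)
      with d inv[of e] have "p dvd e" by (auto simp: D0_def)
      then show "moebius_mu d = 0"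
        using assms(2) by (simp add: e moebius_prime_mult)
    qed
  qed (fact assms(1))
  also have "\<dots> = (\<Sum>d\<in>D0. moebius_mu d) + (\<Sum>d\<in>(*) p ` D0. moebius_mu d)"
    using fin by (intro sum.union_disjoint) (auto simp: D0_def)
  also have "(\<Sum>d\<in>(*) p ` D0. moebius_mu d) = (\<Sum>d\<in>D0. moebius_mu (p * d))"
    using p by (subst sum.reindex) (auto simp: inj_on_def)
  also have "\<dots> = (\<Sum>d\<in>D0. - moebius_mu d)"
    using assms(2) by (intro sum.cong) (auto simp: moebius_prime_mult D0_def)
  finally show ?thesis by (simp add: sum_negf)
qed

text \<open>If \<open>p ^ k\<close> divides \<open>n\<close> and \<open>d\<close> is prime to
  \<open>p\<close>, then \<open>d ^ k\<close> divides \<open>n\<close> exactly when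
  \<open>(p * d) ^ k\<close> does, so the involution applies. Otherwise \<open>d = 1\<close> alone
  contributes. The case \<open>k = 1\<close> gives Moebius inversion, general \<open>k\<close> the
  indicator of the k-free integers.\<close>

lemma sum_moebius_power_divisors:
  assumes n: "n > 0" and k: "k > 0"
  shows "(\<Sum>d | d ^ k dvd n. moebius_mu d) = (if \<exists>p. prime p \<and> p ^ k dvd n then 0 else 1)"
proof (cases "\<exists>p. prime p \<and> p ^ k dvd n")
  case True
  then obtain p where p: "prime p" "p ^ k dvd n" by blast
  have "(\<Sum>d | d ^ k dvd n. moebius_mu d) = 0"
  proof (rule sum_moebius_eq_0)
    have "d \<le> n" if "d ^ k dvd n" for d
    proof (cases "d = 0")
      case False
      then have "d \<le> d ^ k" using k by (simp add: self_le_power)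
      also have "\<dots> \<le> n" using that n by (rule dvd_imp_le)
      finally show ?thesis .
    qed simp
    then show "finite {d. d ^ k dvd n}"
      using finite_subset[of "{d. d ^ k dvd n}" "{..n}"] by auto
    fix d assume "\<not> p dvd d"
    then have "coprime (p ^ k) (d ^ k)"
      using p by (simp add: prime_imp_coprime)
    then show "p * d \<in> {d. d ^ k dvd n} \<longleftrightarrow> d \<in> {d. d ^ k dvd n}"
      using divides_mult[OF p(2)] dvd_mult_right[of "p ^ k" "d ^ k" n] by (auto simp: power_mult_distrib)
  qed (fact p)
  with True show ?thesis by simp
next
  case False
  have "{d. d ^ k dvd n} = {1}"
  proof (intro equalityI subsetI)
    fix d assume d: "d \<in> {d. d ^ k dvd n}"
    show "d \<in> {1}"
    proof (rule ccontr)
      assume "d \<notin> {1}"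
      then obtain p where p: "prime p" "p dvd d"
        using prime_factor_nat[of d] by auto
      then have "p ^ k dvd n"
        using d dvd_trans[OF dvd_power_same[OF p(2)]] by simp
      with p False show False by blast
    qed
  qed simp
  with False show ?thesis by simp
qed

lemma sum_moebius_divisors:
  assumes "n > 0"
  shows "(\<Sum>d | d dvd n. moebius_mu d) = (if n = 1 then 1 else 0)"
proof -
  have "(\<exists>p. prime p \<and> p ^ 1 dvd n) \<longleftrightarrow> n \<noteq> 1"
    using prime_factor_nat[of n] by (auto dest: prime_gt_Suc_0_nat)
  then show ?thesis
    using sum_moebius_power_divisors[OF assms, of 1] by simp
qed

section \<open>Dirichlet series with Moebius coefficients\<close>

lemma has_sum_of_sums_Suc:
  fixes f :: "nat \<Rightarrow> complex"
  assumes "summable (\<lambda>n. norm (f (Suc n)))" "f 0 = 0" "(\<lambda>n. f (Suc n)) sums S"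
  shows "(f has_sum S) UNIV"
proof -
  have "summable (\<lambda>n. norm (f n))"
    using assms(1) by (simp only: summable_Suc_iff[of "\<lambda>n. norm (f n)"])
  moreover have "f sums S"
    using assms(2,3) by (simp add: sums_Suc_iff)
  ultimately show ?thesis
    by (rule norm_summable_imp_has_sum)
qed

text \<open>Complete multiplicativity lets the product of the two absolutely convergent sums be
  regrouped by the product of the indices: \<open>u n\<close> comes out, and the remaining divisor
  sum of \<open>moebius_mu\<close> leaves only \<open>n = 1\<close>.\<close>

lemma dirichlet_inverse_moebius:
  fixes u :: "nat \<Rightarrow> complex"
  assumes u0: "u 0 = 0" and u1: "u 1 = 1" and mult: "\<And>m n. u (m * n) = u m * u n"
    and abs: "(\<lambda>n. norm (u n)) summable_on UNIV"
  shows "(\<Sum>\<^sub>\<infinity>n. of_int (moebius_mu n) * u n) * (\<Sum>\<^sub>\<infinity>n. u n) = 1"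
proof -
  let ?\<mu> = "\<lambda>n. of_int (moebius_mu n) * u n"
  have abs\<mu>: "(\<lambda>n. norm (?\<mu> n)) summable_on UNIV"
  proof (rule summable_on_comparison_test[OF abs])
    fix n
    have "norm (of_int (moebius_mu n) :: complex) \<le> 1"
      using abs_moebius_mu_le[of n] by simp
    then show "norm (?\<mu> n) \<le> norm (u n)"
      unfolding norm_mult by (intro mult_left_le_one_le) auto
  qed auto
  \<comment> \<open>Index 0 has to go before regrouping: every \<open>d\<close> divides 0, so the
    correspondence between factorisations and divisors breaks down there.\<close>
  let ?P = "{0<..} :: nat set"
  let ?h = "\<lambda>(m, n). ?\<mu> m * u n"
  let ?h' = "\<lambda>(n, d). of_int (moebius_mu d) * u n"
  let ?D = "Sigma ?P (\<lambda>n. {d. d dvd n})"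
  have absP: "(\<lambda>n. norm (u n)) summable_on ?P"
    by (rule summable_on_subset_banach[OF abs]) auto
  have absP\<mu>: "(\<lambda>n. norm (?\<mu> n)) summable_on ?P"
    by (rule summable_on_subset_banach[OF abs\<mu>]) auto
  have "(\<lambda>x. norm (?h x)) summable_on ?P \<times> ?P"
  proof (subst Infinite_Sum.abs_summable_on_Sigma_iff, intro conjI ballI)
    show "(\<lambda>n. norm (?h (m, n))) summable_on ?P" for m
      using absP by (simp add: norm_mult summable_on_cmult_right)
    show "(\<lambda>m. norm (\<Sum>\<^sub>\<infinity>n\<in>?P. norm (?h (m, n)))) summable_on ?P"
      using absP\<mu> by (simp add: norm_mult infsum_cmult_right' abs_mult infsum_nonneg summable_on_cmult_left)
  qed
  then have smh: "?h summable_on ?P \<times> ?P"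
    by (rule abs_summable_summable)
  have "bij_betw (\<lambda>(m, n). (m * n, m)) (?P \<times> ?P) ?D"
    by (rule bij_betwI[where g = "\<lambda>(n, d). (d, n div d)"]) (auto intro: Nat.gr0I elim!: dvdE)
  moreover have hh': "?h x = ?h' ((\<lambda>(m, n). (m * n, m)) x)" for x
    by (cases x) (simp add: mult mult_ac)
  ultimately have smh': "?h' summable_on ?D" and eq: "infsum ?h (?P \<times> ?P) = infsum ?h' ?D"
    using smh summable_on_reindex_bij_betw[of "\<lambda>(m, n). (m * n, m)" "?P \<times> ?P" ?D ?h']
      infsum_reindex_bij_betw[of "\<lambda>(m, n). (m * n, m)" "?P \<times> ?P" ?D ?h']
    by (simp_all only: hh'[symmetric])
  have "(\<Sum>\<^sub>\<infinity>n. ?\<mu> n) * (\<Sum>\<^sub>\<infinity>n. u n) = (\<Sum>\<^sub>\<infinity>n\<in>?P. ?\<mu> n) * (\<Sum>\<^sub>\<infinity>n\<in>?P. u n)"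
    by (intro arg_cong2[where f = "(*)"] infsum_cong_neutral) (auto simp: u0)
  also have "\<dots> = (\<Sum>\<^sub>\<infinity>m\<in>?P. \<Sum>\<^sub>\<infinity>n\<in>?P. ?h (m, n))"
    by (simp add: infsum_cmult_right' infsum_cmult_left')
  also have "\<dots> = infsum ?h' ?D"
    unfolding infsum_Sigma_banach[OF smh] by (rule eq)
  also have "\<dots> = (\<Sum>\<^sub>\<infinity>n\<in>?P. \<Sum>\<^sub>\<infinity>d\<in>{d. d dvd n}. ?h' (n, d))"
    by (rule infsum_Sigma_banach[OF smh', symmetric])
  also have "\<dots> = (\<Sum>\<^sub>\<infinity>n\<in>?P. if n = 1 then 1 else 0)"
  proof (rule infsum_cong)
    fix n assume n: "n \<in> ?P"
    then have "(\<Sum>\<^sub>\<infinity>d\<in>{d. d dvd n}. ?h' (n, d)) = of_int (\<Sum>d | d dvd n. moebius_mu d) * u n"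
      by (simp add: infsum_finite sum_distrib_right)
    also have "\<dots> = (if n = 1 then 1 else 0)"
      using sum_moebius_divisors[of n] n u1 by (simp del: of_int_sum)
    finally show "(\<Sum>\<^sub>\<infinity>d\<in>{d. d dvd n}. ?h' (n, d)) = (if n = 1 then 1 else 0)" .
  qed
  also have "\<dots> = (\<Sum>\<^sub>\<infinity>n\<in>{1::nat}. 1)"
    by (rule infsum_cong_neutral) auto
  finally show ?thesis by simp
qed

lemma norm_dirichlet_term_le:
  assumes "\<And>n. norm (a n) \<le> 1" "Re s \<ge> c"
  shows "norm (a (Suc n) * of_nat (Suc n) powr (- s) :: complex) \<le> real (Suc n) powr (- c)"
proof -
  have "norm (a (Suc n) * of_nat (Suc n) powr (- s)) \<le> 1 * real (Suc n) powr (- Re s)"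
    unfolding norm_mult by (intro mult_mono assms) (auto simp: norm_powr_real_powr)
  also have "\<dots> \<le> real (Suc n) powr (- c)"
    using assms(2) by (simp add: powr_mono)
  finally show ?thesis .
qed

lemma summable_Suc_powr: "c > 1 \<Longrightarrow> summable (\<lambda>n. real (Suc n) powr (- c))"
  using summable_real_powr_iff[of "- c"] summable_Suc_iff[of "\<lambda>n. real n powr (- c)"] by simp

lemma summable_norm_dirichlet_series:
  fixes a :: "nat \<Rightarrow> complex"
  assumes "\<And>n. norm (a n) \<le> 1" "Re s > 1"
  shows "summable (\<lambda>n. norm (a (Suc n) * of_nat (Suc n) powr (- s)))"
  by (rule summable_comparison_test'[OF summable_Suc_powr[OF assms(2)], of 0])
     (use norm_dirichlet_term_le[of a, OF assms(1) order_refl] in simp)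

lemma norm_dirichlet_series_le:
  fixes a :: "nat \<Rightarrow> complex"
  assumes "\<And>n. norm (a n) \<le> 1" "Re s \<ge> c" "c > 1"
  shows "norm (\<Sum>n. a (Suc n) * of_nat (Suc n) powr (- s)) \<le> (\<Sum>n. real (Suc n) powr (- c))"
  by (rule norm_suminf_le[OF norm_dirichlet_term_le[OF assms(1,2)] summable_Suc_powr[OF assms(3)]])

lemma moebius_dirichlet_series:
  fixes \<psi> :: "nat \<Rightarrow> complex"
  assumes "\<psi> 1 = 1" "\<And>m n. \<psi> (m * n) = \<psi> m * \<psi> n" "\<And>n. norm (\<psi> n) \<le> 1" and s: "Re s > 1"
  shows "(\<Sum>n. of_int (moebius_mu (Suc n)) * \<psi> (Suc n) * of_nat (Suc n) powr (- s)) *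
         (\<Sum>n. \<psi> (Suc n) * of_nat (Suc n) powr (- s)) = 1"
proof -
  define u where "u = (\<lambda>n. \<psi> n * of_nat n powr (- s))"
  have b: "norm (of_int (moebius_mu n) * \<psi> n) \<le> 1" for n
    using mult_mono[of "norm (of_int (moebius_mu n) :: complex)" 1 "norm (\<psi> n)" 1] abs_moebius_mu_le[of n] assms(3)[of n]
    by (simp add: norm_mult)
  have h1: "(u has_sum (\<Sum>n. \<psi> (Suc n) * of_nat (Suc n) powr (- s))) UNIV"
    using summable_norm_dirichlet_series[of \<psi> s, OF assms(3) s]
    by (intro has_sum_of_sums_Suc) (auto simp: u_def simp del: of_nat_Suc intro: summable_sums summable_norm_cancel)
  have h2: "((\<lambda>n. of_int (moebius_mu n) * u n) has_sum
      (\<Sum>n. of_int (moebius_mu (Suc n)) * \<psi> (Suc n) * of_nat (Suc n) powr (- s))) UNIV"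
    using summable_norm_dirichlet_series[of "\<lambda>n. of_int (moebius_mu n) * \<psi> n" s, OF b s]
    by (intro has_sum_of_sums_Suc)
       (auto simp: u_def mult.assoc simp del: of_nat_Suc intro: summable_sums summable_norm_cancel)
  have "(\<Sum>\<^sub>\<infinity>n. of_int (moebius_mu n) * u n) * (\<Sum>\<^sub>\<infinity>n. u n) = 1"
  proof (rule dirichlet_inverse_moebius)
    show "u (m * n) = u m * u n" for m n
      by (simp add: u_def assms(2) powr_times_real)
    have "(\<lambda>n. norm (u n)) summable_on UNIV"
    proof (rule norm_summable_imp_summable_on)
      have "summable (\<lambda>n. norm (u n))"
        using summable_norm_dirichlet_series[of \<psi> s, OF assms(3) s]
        by (subst summable_Suc_iff[symmetric]) (simp add: u_def del: of_nat_Suc)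
      then show "summable (\<lambda>n. norm (norm (u n)))" by simp
    qed
    then show "(\<lambda>n. norm (u n)) summable_on UNIV" .
  qed (use assms(1) in \<open>auto simp: u_def\<close>)
  then show ?thesis
    using h1 h2 by (simp add: infsumI)
qed

section \<open>Dirichlet series in the critical strip\<close>

text \<open>The exponent \<open>Re s + 1\<close> is what differencing smooth terms gains over
  \<open>Re s\<close>. It makes the series converge locally uniformly on all of
  \<open>Re s > 0\<close>, and the factor \<open>(1 + norm s) ^ 2\<close> passes to the sum as the
  polynomial growth that \<open>reciprocal_growth\<close> asks for.\<close>

lemma holomorphic_series_halfplane:
  fixes f :: "nat \<Rightarrow> complex \<Rightarrow> complex"
  assumes hol: "\<And>n. f n holomorphic_on {s. Re s > 0}"
    and bd: "\<And>n s. Re s > 0 \<Longrightarrow> norm (f n s) \<le> (1 + norm s) ^ 2 * real (Suc n) powr (- (Re s + 1))"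
  shows "(\<lambda>s. \<Sum>n. f n s) holomorphic_on {s. Re s > 0}"
    and "\<And>s. Re s > 0 \<Longrightarrow> summable (\<lambda>n. f n s)"
    and "\<And>\<sigma>. \<sigma> > 0 \<Longrightarrow> \<exists>C. \<forall>s. \<sigma> \<le> Re s \<longrightarrow> norm (\<Sum>n. f n s) \<le> C * (1 + norm s) ^ 2"
proof -
  have bd': "norm (f n s) \<le> (1 + norm s) ^ 2 * real (Suc n) powr (- (\<sigma> + 1))" if "0 < \<sigma>" "\<sigma> \<le> Re s" for n s \<sigma>
    by (rule order_trans[OF bd]) (use that in \<open>auto intro!: mult_left_mono powr_mono\<close>)
  show "(\<lambda>s. \<Sum>n. f n s) holomorphic_on {s. Re s > 0}"
  proof (rule holomorphic_uniform_sequence)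
    show "open {s. Re s > 0}" by (rule open_halfspace_Re_gt)
    show "(\<lambda>s. \<Sum>i<n. f i s) holomorphic_on {s. Re s > 0}" for n
      by (intro holomorphic_intros hol)
    fix x assume x: "x \<in> {s. Re s > 0}"
    define d where "d = Re x / 2"
    have re: "d \<le> Re y" "norm y \<le> norm x + d" if "y \<in> cball x d" for y
      using that abs_Re_le_cmod[of "x - y"] norm_triangle_ineq3[of x y] unfolding d_def
      by (auto simp: dist_norm)
    have sm: "summable (\<lambda>n. real (Suc n) powr (- (d + 1)))"
      using x by (intro summable_Suc_powr) (simp add: d_def)
    have "uniform_limit (cball x d) (\<lambda>n s. \<Sum>i<n. f i s) (\<lambda>s. \<Sum>n. f n s) sequentially"
    proof (rule Weierstrass_m_test)
      fix n y assume y: "y \<in> cball x d"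
      have "norm (f n y) \<le> (1 + norm y) ^ 2 * real (Suc n) powr (- (d + 1))"
        using re[OF y] x by (intro bd') (auto simp: d_def)
      also have "\<dots> \<le> (1 + (norm x + d)) ^ 2 * real (Suc n) powr (- (d + 1))"
        using re[OF y] by (intro mult_right_mono power_mono) auto
      finally show "norm (f n y) \<le> (1 + (norm x + d)) ^ 2 * real (Suc n) powr (- (d + 1))" .
    qed (rule summable_mult[OF sm])
    moreover have d: "0 < d"
      using x by (simp add: d_def)
    moreover have "cball x d \<subseteq> {s. Re s > 0}"
      using less_le_trans[OF d re(1)] by blast
    ultimately show "\<exists>d>0. cball x d \<subseteq> {s. Re s > 0} \<and>
        uniform_limit (cball x d) (\<lambda>n s. \<Sum>i<n. f i s) (\<lambda>s. \<Sum>n. f n s) sequentially"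
      by blast
  qed
  show "summable (\<lambda>n. f n s)" if "Re s > 0" for s
  proof (rule summable_comparison_test')
    show "summable (\<lambda>n. (1 + norm s) ^ 2 * real (Suc n) powr (- (Re s + 1)))"
      using that by (intro summable_mult summable_Suc_powr) simp
  qed (rule bd[OF that])
  show "\<exists>C. \<forall>s. \<sigma> \<le> Re s \<longrightarrow> norm (\<Sum>n. f n s) \<le> C * (1 + norm s) ^ 2" if \<sigma>: "\<sigma> > 0" for \<sigma>
  proof (intro exI allI impI)
    fix s assume "\<sigma> \<le> Re s"
    have sm: "summable (\<lambda>n. real (Suc n) powr (- (\<sigma> + 1)))"
      using \<sigma> by (intro summable_Suc_powr) auto
    have "norm (\<Sum>n. f n s) \<le> (\<Sum>n. (1 + norm s) ^ 2 * real (Suc n) powr (- (\<sigma> + 1)))"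
      by (intro norm_suminf_le[OF bd' summable_mult[OF sm]]) fact+
    also have "\<dots> = (1 + norm s) ^ 2 * (\<Sum>n. real (Suc n) powr (- (\<sigma> + 1)))"
      by (rule suminf_mult[OF sm])
    finally show "norm (\<Sum>n. f n s) \<le> (\<Sum>n. real (Suc n) powr (- (\<sigma> + 1))) * (1 + norm s) ^ 2"
      by (simp only: mult.commute)
  qed
qed

section \<open>Continuation of the zeta function\<close>

lemma closed_segment_of_real_cases:
  fixes a b :: real
  assumes "a \<le> b" "z \<in> closed_segment (of_real a) (of_real b :: complex)"
  obtains u where "z = of_real u" "a \<le> u" "u \<le> b"
  using assms by (auto simp: closed_segment_of_real closed_segment_eq_real_ivl)

lemma norm_powr_diff_le:
  fixes a b :: real and s :: complex
  assumes "0 < a" "a \<le> b" "Re s > 0"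
  shows "norm (of_real b powr (- s) - of_real a powr (- s)) \<le> norm s * a powr (- (Re s + 1)) * (b - a)"
proof -
  let ?S = "closed_segment (of_real a) (of_real b :: complex)"
  have "norm (of_real b powr (- s) - of_real a powr (- s))
      \<le> norm s * a powr (- (Re s + 1)) * norm (of_real b - of_real a :: complex)"
  proof (rule field_differentiable_bound[where S = ?S and f' = "\<lambda>z. - s * z powr (- s - 1)"])
    fix z assume "z \<in> ?S"
    then obtain u where u: "z = of_real u" "a \<le> u" "u \<le> b"
      using closed_segment_of_real_cases assms by blast
    have "z \<notin> \<real>\<^sub>\<le>\<^sub>0" using u assms by simp
    then show "((\<lambda>z. z powr (- s)) has_field_derivative - s * z powr (- s - 1)) (at z within ?S)"
      by (auto intro!: derivative_eq_intros)
    have "norm (- s * z powr (- s - 1)) = norm s * u powr (- (Re s + 1))"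
      using u assms by (simp add: norm_mult norm_powr_real_powr)
    also have "\<dots> \<le> norm s * a powr (- (Re s + 1))"
      using u assms by (intro mult_left_mono powr_mono2') auto
    finally show "norm (- s * z powr (- s - 1)) \<le> norm s * a powr (- (Re s + 1))" .
  qed auto
  also have "norm (of_real b - of_real a :: complex) = b - a"
    using assms by (simp flip: of_real_diff)
  finally show ?thesis .
qed

text \<open>The terms are \<open>(s - 1)\<close> times the integral of \<open>(n+1)\<^bsup>-s\<^esup> - u\<^bsup>-s\<^esup>\<close> over \<open>n + 1 \<le> u \<le> n + 2\<close>.\<close>

definition zeta_term :: "nat \<Rightarrow> complex \<Rightarrow> complex" where
  "zeta_term n s = (s - 1) * of_nat (Suc n) powr (- s)
     + of_nat (Suc (Suc n)) powr (1 - s) - of_nat (Suc n) powr (1 - s)"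

text \<open>The term is the increment of \<open>?F\<close> over a unit interval, and the derivative
  of \<open>?F\<close> contains a difference of two values of \<open>z powr (- s)\<close>, to which
  a second mean value estimate applies; this gains the extra power.\<close>

lemma norm_zeta_term_le:
  assumes s: "Re s > 0"
  shows "norm (zeta_term n s) \<le> (1 + norm s) ^ 2 * real (Suc n) powr (- (Re s + 1))"
proof -
  define a where "a = real (Suc n)"
  have a: "a > 0" by (simp add: a_def)
  let ?S = "closed_segment (of_real a) (of_real (a + 1) :: complex)"
  let ?F = "\<lambda>z. (s - 1) * of_real a powr (- s) * z + z powr (1 - s)"
  have "norm (?F (of_real (a + 1)) - ?F (of_real a))
      \<le> (1 + norm s) ^ 2 * a powr (- (Re s + 1)) * norm (of_real (a + 1) - of_real a :: complex)"
  proof (rule field_differentiable_bound[where S = ?S and f' = "\<lambda>z. (s - 1) * (of_real a powr (- s) - z powr (- s))"])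
    fix z assume "z \<in> ?S"
    then obtain u where u: "z = of_real u" "a \<le> u" "u \<le> a + 1"
      using closed_segment_of_real_cases[of a "a + 1"] by auto
    have "z \<notin> \<real>\<^sub>\<le>\<^sub>0" using u a by simp
    then show "(?F has_field_derivative (s - 1) * (of_real a powr (- s) - z powr (- s))) (at z within ?S)"
      by (auto intro!: derivative_eq_intros simp: algebra_simps)
    have "norm (of_real a powr (- s) - z powr (- s)) \<le> norm s * a powr (- (Re s + 1)) * (u - a)"
      unfolding u(1) using norm_powr_diff_le[OF a u(2) s] by (simp add: norm_minus_commute)
    also have "\<dots> \<le> norm s * a powr (- (Re s + 1)) * 1"
      using u by (intro mult_left_mono) auto
    finally have 1: "norm (of_real a powr (- s) - z powr (- s)) \<le> norm s * a powr (- (Re s + 1))" by simp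
    have "norm ((s - 1) * (of_real a powr (- s) - z powr (- s))) \<le> (1 + norm s) * ((1 + norm s) * a powr (- (Re s + 1)))"
      unfolding norm_mult using norm_triangle_ineq4[of s 1]
      by (intro mult_mono order_trans[OF 1] mult_right_mono) auto
    then show "norm ((s - 1) * (of_real a powr (- s) - z powr (- s))) \<le> (1 + norm s) ^ 2 * a powr (- (Re s + 1))"
      by (simp add: power2_eq_square mult_ac)
  qed auto
  also have "?F (of_real (a + 1)) - ?F (of_real a) = zeta_term n s"
    by (simp add: zeta_term_def a_def algebra_simps)
  also have "norm (of_real (a + 1) - of_real a :: complex) = 1" by simp
  finally show ?thesis by (simp add: a_def)
qed

text \<open>This is \<open>(s - 1) \<zeta>(s)\<close> on \<open>Re s > 0\<close>.\<close>

definition zeta_num :: "complex \<Rightarrow> complex" where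
  "zeta_num s = 1 + (\<Sum>n. zeta_term n s)"

lemma holomorphic_zeta_term: "zeta_term n holomorphic_on S"
  unfolding zeta_term_def by (intro holomorphic_intros) (auto simp: of_nat_eq_0_iff simp del: of_nat_Suc)

lemma holomorphic_zeta_num: "zeta_num holomorphic_on {s. Re s > 0}"
  unfolding zeta_num_def
  by (intro holomorphic_intros holomorphic_series_halfplane(1) holomorphic_zeta_term norm_zeta_term_le)

lemma zeta_num_growth:
  assumes "\<sigma> > 0"
  shows "\<exists>C. \<forall>s. \<sigma> \<le> Re s \<longrightarrow> norm (zeta_num s) \<le> C * (1 + norm s) ^ 2"
proof -
  obtain C where C: "\<And>s. \<sigma> \<le> Re s \<Longrightarrow> norm (\<Sum>n. zeta_term n s) \<le> C * (1 + norm s) ^ 2"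
    using holomorphic_series_halfplane(3)[OF holomorphic_zeta_term norm_zeta_term_le assms] by auto
  have "norm (zeta_num s) \<le> (1 + C) * (1 + norm s) ^ 2" if "\<sigma> \<le> Re s" for s
  proof -
    have "norm (zeta_num s) \<le> norm (1 :: complex) + norm (\<Sum>n. zeta_term n s)"
      unfolding zeta_num_def by (rule norm_triangle_ineq)
    also have "\<dots> \<le> (1 + norm s) ^ 2 + C * (1 + norm s) ^ 2"
      using C[OF that] by (intro add_mono) (auto simp: one_le_power)
    finally show ?thesis by (simp add: algebra_simps)
  qed
  then show ?thesis by blast
qed

text \<open>The value is the residue of zeta at 1. Being nonzero, it makes the reciprocal of zeta
  holomorphic at 1.\<close>

lemma zeta_num_1: "zeta_num 1 = 1"
  by (simp add: zeta_num_def zeta_term_def del: of_nat_Suc)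

text \<open>The powers with exponent \<open>1 - s\<close> telescope to \<open>-1\<close>, which
  cancels the 1 in \<open>zeta_num\<close>.\<close>

lemma zeta_sums:
  assumes s: "Re s > 1"
  shows "(\<lambda>n. of_nat (Suc n) powr (- s)) sums (zeta_num s / (s - 1))"
proof -
  define g where "g = (\<lambda>n. of_nat (Suc n) powr (1 - s) :: complex)"
  have "g \<longlonglongrightarrow> 0"
  proof (rule tendsto_norm_zero_cancel)
    have "(\<lambda>n. real (Suc n) powr (1 - Re s)) \<longlonglongrightarrow> 0"
      using s by (intro tendsto_neg_powr filterlim_compose[OF filterlim_real_sequentially filterlim_Suc]) auto
    then show "(\<lambda>n. norm (g n)) \<longlonglongrightarrow> 0"
      by (simp add: g_def norm_powr_real_powr)
  qed
  then have 1: "(\<lambda>n. g (Suc n) - g n) sums (0 - g 0)"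
    by (rule telescope_sums)
  have 2: "(\<lambda>n. zeta_term n s) sums (zeta_num s - 1)"
    using holomorphic_series_halfplane(2)[OF holomorphic_zeta_term norm_zeta_term_le, of s] s
    by (simp add: zeta_num_def summable_sums)
  have "(\<lambda>n. zeta_term n s - (g (Suc n) - g n)) sums (zeta_num s - 1 - (0 - g 0))"
    by (rule sums_diff[OF 2 1])
  then have "(\<lambda>n. (s - 1) * of_nat (Suc n) powr (- s)) sums zeta_num s"
    by (simp add: zeta_term_def g_def)
  then have "(\<lambda>n. (s - 1) * of_nat (Suc n) powr (- s) / (s - 1)) sums (zeta_num s / (s - 1))"
    by (rule sums_divide)
  moreover have "s \<noteq> 1" using s by auto
  ultimately show ?thesis by simp
qed

text \<open>The pole confines the continuation of zeta to the half-plane punctured at 1; the point 1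
  itself is settled by \<open>zeta_num_1\<close>.\<close>

lemma zeta_num_nonzero:
  assumes "zeros_on_critical_line (\<lambda>_. 1)" "Re s > 1 / 2"
  shows "zeta_num s \<noteq> 0"
proof (cases "s = 1")
  case False
  let ?A = "{s. Re s > 0} - {1}"
  have "continues_dirichlet_series (\<lambda>_. 1) ?A (\<lambda>s. zeta_num s / (s - 1))"
    unfolding continues_dirichlet_series_def
  proof (intro conjI allI impI)
    show "open ?A" by (intro open_Diff open_halfspace_Re_gt) auto
    show "connected ?A"
      by (intro connected_open_delete open_halfspace_Re_gt convex_connected convex_halfspace_Re_gt) auto
    show "(\<lambda>s. zeta_num s / (s - 1)) holomorphic_on ?A"
      by (intro holomorphic_intros holomorphic_on_subset[OF holomorphic_zeta_num]) auto
  qed (auto intro: zeta_sums[simplified])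
  then have "zeta_num s / (s - 1) = 0 \<longrightarrow> Re s = 1 / 2"
    using assms False unfolding zeros_on_critical_line_def by force
  with assms(2) show ?thesis by auto
qed (simp add: zeta_num_1)


section \<open>The character modulo 3 and its L-function\<close>

definition chi3 :: "nat \<Rightarrow> complex" where
  "chi3 n = (if n mod 3 = 1 then 1 else if n mod 3 = 2 then -1 else 0)"

lemma chi3_mult: "chi3 (m * n) = chi3 m * chi3 n"
proof -
  have "m mod 3 = 0 \<or> m mod 3 = 1 \<or> m mod 3 = 2" "n mod 3 = 0 \<or> n mod 3 = 1 \<or> n mod 3 = 2"
    by linarith+
  moreover have "(m * n) mod 3 = ((m mod 3) * (n mod 3)) mod 3"
    by (simp add: mod_mult_eq)
  ultimately show ?thesis
    unfolding chi3_def by (elim disjE) simp_all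
qed

lemma norm_chi3_le: "norm (chi3 n) \<le> 1"
  by (simp add: chi3_def)

lemma chi3_eq_0_iff: "chi3 n = 0 \<longleftrightarrow> 3 dvd n"
  unfolding chi3_def by (simp add: dvd_eq_mod_eq_0)

lemma dirichlet_character_chi3: "dirichlet_character 3 chi3"
  unfolding dirichlet_character_def
proof (intro conjI allI)
  show "chi3 n \<noteq> 0 \<longleftrightarrow> coprime n 3" for n
    using prime_imp_coprime[of 3 n] coprime_common_divisor[of n 3 3]
    by (auto simp: chi3_eq_0_iff coprime_commute)
qed (simp_all add: chi3_mult, simp add: chi3_def)

text \<open>One period of the character, the multiple of 3 contributing nothing. Grouped like this,
  the values 1 and -1 cancel enough for absolute convergence on \<open>Re s > 0\<close>.\<close>

definition L3_term :: "nat \<Rightarrow> complex \<Rightarrow> complex" where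
  "L3_term m s = of_nat (3 * m + 1) powr (- s) - of_nat (3 * m + 2) powr (- s)"

definition L3 :: "complex \<Rightarrow> complex" where
  "L3 s = (\<Sum>m. L3_term m s)"

lemma norm_L3_term_le:
  assumes s: "Re s > 0"
  shows "norm (L3_term m s) \<le> (1 + norm s) ^ 2 * real (Suc m) powr (- (Re s + 1))"
proof -
  have "norm (L3_term m s) = norm (of_real (real (3 * m + 2)) powr (- s) - of_real (real (3 * m + 1)) powr (- s))"
    unfolding L3_term_def of_real_of_nat_eq by (rule norm_minus_commute)
  also have "\<dots> \<le> norm s * real (3 * m + 1) powr (- (Re s + 1)) * (real (3 * m + 2) - real (3 * m + 1))"
    by (rule norm_powr_diff_le) (use s in auto)
  also have "\<dots> = norm s * real (3 * m + 1) powr (- (Re s + 1))"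
    by simp
  also have "\<dots> \<le> (1 + norm s) ^ 2 * real (Suc m) powr (- (Re s + 1))"
  proof (intro mult_mono powr_mono2')
    show "norm s \<le> (1 + norm s) ^ 2"
      by (simp add: power2_eq_square algebra_simps)
  qed (use s in auto)
  finally show ?thesis .
qed

lemma holomorphic_L3_term: "L3_term m holomorphic_on S"
  unfolding L3_term_def by (intro holomorphic_intros) (auto simp: of_nat_eq_0_iff simp del: of_nat_add of_nat_mult of_nat_Suc)

lemma holomorphic_L3: "L3 holomorphic_on {s. Re s > 0}"
  unfolding L3_def by (intro holomorphic_series_halfplane(1) holomorphic_L3_term norm_L3_term_le)

lemma L3_growth: "\<sigma> > 0 \<Longrightarrow> \<exists>C. \<forall>s. \<sigma> \<le> Re s \<longrightarrow> norm (L3 s) \<le> C * (1 + norm s) ^ 2"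
  unfolding L3_def by (rule holomorphic_series_halfplane(3)[OF holomorphic_L3_term norm_L3_term_le])

lemma L3_sums:
  assumes s: "Re s > 1"
  shows "(\<lambda>n. chi3 (Suc n) * of_nat (Suc n) powr (- s)) sums L3 s"
proof -
  let ?f = "\<lambda>n. chi3 (Suc n) * of_nat (Suc n) powr (- s)"
  have "summable ?f"
    by (rule summable_norm_cancel[OF summable_norm_dirichlet_series[OF norm_chi3_le s]])
  then have S: "?f sums suminf ?f" by (rule summable_sums)
  have "(\<lambda>m. sum ?f {m * 3..<m * 3 + 3}) sums suminf ?f"
    by (rule sums_group[OF S]) simp
  moreover have "sum ?f {m * 3..<m * 3 + 3} = L3_term m s" for m
  proof -
    have "{m * 3..<m * 3 + 3} = {3 * m, 3 * m + 1, 3 * m + 2}" by auto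
    moreover have "chi3 (Suc (3 * m)) = 1" "chi3 (Suc (3 * m + 1)) = -1" "chi3 (Suc (3 * m + 2)) = 0"
      unfolding chi3_def by (simp_all add: mod_Suc)
    ultimately show ?thesis
      by (simp add: L3_term_def del: of_nat_Suc of_nat_add of_nat_mult)
  qed
  ultimately have "(\<lambda>m. L3_term m s) sums suminf ?f" by simp
  then have "L3 s = suminf ?f" unfolding L3_def by (rule sums_unique[symmetric])
  with S show ?thesis by simp
qed

lemma L3_nonzero:
  assumes "zeros_on_critical_line chi3" "Re s > 1 / 2"
  shows "L3 s \<noteq> 0"
proof -
  have "continues_dirichlet_series chi3 {s. Re s > 0} L3"
    unfolding continues_dirichlet_series_def
    using open_halfspace_Re_gt[of 0] convex_connected[OF convex_halfspace_Re_gt[of 0]] holomorphic_L3 L3_sums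
    by auto
  then show ?thesis
    using assms unfolding zeros_on_critical_line_def by force
qed

section \<open>The completely multiplicative modification of the character\<close>

text \<open>Removing the powers of 3 before evaluating the character yields the value 1 at 3. At 0
  the result is \<open>chi3 0 = 0\<close>, so multiplicativity has no exception.\<close>

definition g3 :: "nat \<Rightarrow> complex" where
  "g3 n = chi3 (n div 3 ^ multiplicity 3 n)"

lemma g3_eq:
  assumes "\<not> 3 dvd m"
  shows "g3 (3 ^ a * m) = chi3 m"
proof -
  have "multiplicity 3 (3 ^ a * m) = a"
    using assms by (intro multiplicity_decomposeI) auto
  then show ?thesis by (simp add: g3_def)
qed

lemma pow3_decomp:
  assumes "n > (0::nat)"
  obtains a m where "n = 3 ^ a * m" "\<not> 3 dvd m"
  by (rule multiplicity_decompose'[of n 3]) (use assms that in auto)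

lemma g3_not_dvd: "\<not> 3 dvd m \<Longrightarrow> g3 m = chi3 m"
  using g3_eq[of m 0] by simp

lemma g3_0 [simp]: "g3 0 = 0"
  by (simp add: g3_def chi3_def)

lemma g3_mult: "g3 (m * n) = g3 m * g3 n"
proof (cases "m = 0 \<or> n = 0")
  case False
  then obtain a m' b n' where mn: "m = 3 ^ a * m'" "n = 3 ^ b * n'" "\<not> 3 dvd m'" "\<not> 3 dvd n'"
    using pow3_decomp[of m] pow3_decomp[of n] by (metis not_gr_zero)
  have "\<not> 3 dvd m' * n'"
    using mn(3,4) by (simp add: prime_dvd_mult_iff)
  moreover have "m * n = 3 ^ (a + b) * (m' * n')"
    using mn by (simp add: power_add mult_ac)
  ultimately have "g3 (m * n) = chi3 (m' * n')"
    using g3_eq[of "m' * n'" "a + b"] by (simp only: not_False_eq_True)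
  moreover have "g3 m = chi3 m'" "g3 n = chi3 n'"
    using g3_eq[OF mn(3)] g3_eq[OF mn(4)] mn(1,2) by (simp_all only:)
  ultimately show ?thesis
    by (simp only: chi3_mult)
qed auto

lemma g3_3: "g3 3 = 1"
  using g3_eq[of 1 1] by (simp add: chi3_def)

lemma g3_1: "g3 1 = 1"
  using g3_eq[of 1 0] by (simp add: chi3_def)

lemma g3_values:
  assumes "n > 0"
  shows "g3 n \<in> {-1, 1}"
proof -
  obtain a m where "n = 3 ^ a * m" "\<not> 3 dvd m"
    using assms by (rule pow3_decomp)
  then show ?thesis
    using g3_eq[of m a] chi3_eq_0_iff[of m] by (auto simp: chi3_def split: if_splits)
qed

lemma norm_g3_le: "norm (g3 n) \<le> 1"
  by (simp add: g3_def norm_chi3_le)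

text \<open>The multiples of 3 contribute \<open>3 powr (- s)\<close> times the whole series,
  because \<open>g3\<close> ignores a factor 3; subtracting them leaves the series of
  \<open>chi3\<close>.\<close>

lemma g3_series:
  assumes s: "Re s > 1"
  shows "(\<Sum>n. g3 (Suc n) * of_nat (Suc n) powr (- s)) * (1 - 3 powr (- s)) = L3 s"
proof -
  define u where "u = (\<lambda>n. g3 n * of_nat n powr (- s))"
  define S where "S = (\<Sum>n. g3 (Suc n) * of_nat (Suc n) powr (- s))"
  have h1: "(u has_sum S) UNIV"
    using summable_norm_dirichlet_series[of g3 s, OF norm_g3_le s]
    by (intro has_sum_of_sums_Suc)
       (auto simp: u_def S_def simp del: of_nat_Suc intro: summable_sums summable_norm_cancel)
  have "((\<lambda>n. chi3 n * of_nat n powr (- s)) has_sum L3 s) UNIV"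
    using summable_norm_dirichlet_series[of chi3 s, OF norm_chi3_le s] L3_sums[OF s]
    by (intro has_sum_of_sums_Suc) (auto simp del: of_nat_Suc)
  also have "?this \<longleftrightarrow> (u has_sum L3 s) (UNIV - range ((*) 3))"
    by (intro has_sum_cong_neutral) (auto simp: u_def chi3_eq_0_iff g3_not_dvd dvd_def image_iff)
  finally have h2: "(u has_sum L3 s) (UNIV - range ((*) 3))" .
  have "((\<lambda>n. 3 powr (- s) * u n) has_sum (3 powr (- s) * S)) UNIV"
    by (rule has_sum_cmult_right[OF h1])
  also have "(\<lambda>n. 3 powr (- s) * u n) = u \<circ> (*) 3"
    by (auto simp: u_def g3_mult g3_3 powr_times_real fun_eq_iff)
  finally have "(u has_sum (3 powr (- s) * S)) (range ((*) 3))"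
    by (subst has_sum_reindex) (simp_all add: inj_on_def o_def)
  from has_sum_Diff[OF h1 this] have "(u has_sum (S - 3 powr (- s) * S)) (UNIV - range ((*) 3))"
    by simp
  with h2 have "L3 s = S - 3 powr (- s) * S"
    by (rule has_sum_unique)
  then show ?thesis by (simp add: S_def algebra_simps)
qed

section \<open>Square-root cancellation in Moebius sums\<close>

lemma moebius_twisted_sum_bound:
  fixes \<psi> :: "nat \<Rightarrow> complex" and L G :: "complex \<Rightarrow> complex" and \<eta> :: real
  assumes \<psi>: "\<psi> 1 = 1" "\<And>m n. \<psi> (m * n) = \<psi> m * \<psi> n" "\<And>n. norm (\<psi> n) \<le> 1"
    and holL: "L holomorphic_on {s. Re s > 1 / 2} - {1}"
    and nz: "\<And>s. Re s > 1 / 2 \<Longrightarrow> s \<noteq> 1 \<Longrightarrow> L s \<noteq> 0"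
    and growth: "\<And>\<sigma>. \<sigma> > 1 / 2 \<Longrightarrow>
      \<exists>C. \<forall>s. \<sigma> \<le> Re s \<longrightarrow> 1 \<le> \<bar>Im s\<bar> \<longrightarrow> norm (L s) \<le> C * (1 + norm s) ^ 2"
    and series: "\<And>s. Re s > 1 \<Longrightarrow> L s = (\<Sum>n. \<psi> (Suc n) * of_nat (Suc n) powr (- s))"
    and holG: "G holomorphic_on {s. Re s > 1 / 2}"
    and G: "\<And>s. Re s > 1 / 2 \<Longrightarrow> s \<noteq> 1 \<Longrightarrow> G s = inverse (L s)"
    and \<eta>: "\<eta> > 0"
  shows "\<exists>C. \<forall>N. norm (\<Sum>n=1..N. of_int (moebius_mu n) * \<psi> n) \<le> C * real N powr (1 / 2 + \<eta>)"
proof (rule sum_bound_of_dirichlet_series_growth[OF _ holG _ _ \<eta>])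
  let ?a = "\<lambda>n. of_int (moebius_mu n) * \<psi> n"
  \<comment> \<open>This is zeta(3/2). It serves for \<open>L\<close> and its reciprocal alike, as
    both Dirichlet series have coefficients of modulus at most 1.\<close>
  let ?B = "\<Sum>n. real (Suc n) powr (- (3 / 2))"
  show a: "norm (?a n) \<le> 1" for n
    using mult_mono[of "norm (of_int (moebius_mu n) :: complex)" 1 "norm (\<psi> n)" 1] abs_moebius_mu_le[of n] \<psi>(3)[of n]
    by (simp add: norm_mult)
  have inv: "(\<Sum>n. ?a (Suc n) * of_nat (Suc n) powr (- s)) = inverse (L s)" if "Re s > 1" for s
    using moebius_dirichlet_series[of \<psi> s, OF \<psi> that] series[OF that]
    by (intro inverse_unique[symmetric]) (simp add: mult.commute)
  show "(\<lambda>n. ?a (Suc n) * of_nat (Suc n) powr (- s)) sums G s" if s: "Re s > 1" for s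
  proof -
    have "G s = inverse (L s)" using s by (intro G) auto
    then show ?thesis
      using summable_sums[OF summable_norm_cancel[OF summable_norm_dirichlet_series[of ?a, OF a s]]] inv[OF s]
      by simp
  qed
  show "\<exists>C. \<forall>s. \<sigma> \<le> Re s \<longrightarrow> Re s \<le> 2 \<longrightarrow> norm (G s) \<le> C * (1 + \<bar>Im s\<bar>) powr \<epsilon>"
    if "\<sigma> > 1 / 2" "\<epsilon> > 0" for \<sigma> \<epsilon>
  proof (rule reciprocal_growth[OF holL nz growth _ _ holG G that])
    show "norm (L s) \<le> ?B" if "Re s \<ge> 3 / 2" for s
      using norm_dirichlet_series_le[of \<psi> "3 / 2" s, OF \<psi>(3)] that by (subst series) auto
    show "norm (inverse (L s)) \<le> ?B" if "Re s \<ge> 3 / 2" for s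
      using norm_dirichlet_series_le[of ?a "3 / 2" s, OF a] that by (subst inv[symmetric]) auto
  qed
qed

theorem mertens_bound:
  assumes "zeros_on_critical_line (\<lambda>_. 1)" "\<eta> > 0"
  shows "\<exists>C. \<forall>N. norm (\<Sum>n=1..N. of_int (moebius_mu n) :: complex) \<le> C * real N powr (1 / 2 + \<eta>)"
proof -
  have "\<exists>C. \<forall>N. norm (\<Sum>n=1..N. of_int (moebius_mu n) * (1::complex)) \<le> C * real N powr (1 / 2 + \<eta>)"
  proof (rule moebius_twisted_sum_bound[where L = "\<lambda>s. zeta_num s / (s - 1)" and G = "\<lambda>s. (s - 1) / zeta_num s"])
    show "(\<lambda>s. zeta_num s / (s - 1)) holomorphic_on {s. Re s > 1 / 2} - {1}"
      by (intro holomorphic_intros holomorphic_on_subset[OF holomorphic_zeta_num]) auto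
    show "(\<lambda>s. (s - 1) / zeta_num s) holomorphic_on {s. Re s > 1 / 2}"
      using zeta_num_nonzero[OF assms(1)]
      by (intro holomorphic_intros holomorphic_on_subset[OF holomorphic_zeta_num]) auto
    show "zeta_num s / (s - 1) \<noteq> 0" if "Re s > 1 / 2" "s \<noteq> 1" for s
      using zeta_num_nonzero[OF assms(1) that(1)] that(2) by simp
    show "zeta_num s / (s - 1) = (\<Sum>n. 1 * of_nat (Suc n) powr (- s))" if "Re s > 1" for s
      using sums_unique[OF zeta_sums[OF that]] by simp
    show "\<exists>C. \<forall>s. \<sigma> \<le> Re s \<longrightarrow> 1 \<le> \<bar>Im s\<bar> \<longrightarrow> norm (zeta_num s / (s - 1)) \<le> C * (1 + norm s) ^ 2"
      if \<sigma>: "\<sigma> > 1 / 2" for \<sigma>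
    proof -
      obtain C where C: "\<And>s. \<sigma> \<le> Re s \<Longrightarrow> norm (zeta_num s) \<le> C * (1 + norm s) ^ 2"
        using zeta_num_growth[of \<sigma>] \<sigma> by auto
      have "norm (zeta_num s / (s - 1)) \<le> C * (1 + norm s) ^ 2" if "\<sigma> \<le> Re s" "1 \<le> \<bar>Im s\<bar>" for s
      proof -
        \<comment> \<open>Away from the real axis the denominator does no harm, which is why growth
          is demanded only where \<open>\<bar>Im s\<bar> \<ge> 1\<close>.\<close>
        have "1 \<le> norm (s - 1)"
          using abs_Im_le_cmod[of "s - 1"] that by simp
        then have "norm (zeta_num s / (s - 1)) \<le> norm (zeta_num s) / 1"
          unfolding norm_divide by (intro divide_left_mono) auto
        with C[OF that(1)] show ?thesis by simp
      qed
      then show ?thesis by blast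
    qed
  qed (use assms in auto)
  then show ?thesis by simp
qed

theorem mertens_bound_g3:
  assumes "zeros_on_critical_line chi3" "\<eta> > 0"
  shows "\<exists>C. \<forall>N. norm (\<Sum>n=1..N. of_int (moebius_mu n) * g3 n) \<le> C * real N powr (1 / 2 + \<eta>)"
proof -
  \<comment> \<open>A lower bound for the modulus of the Euler factor at 3, whose zeros all lie on
    \<open>Re s = 0\<close>.\<close>
  define c :: real where "c = 1 - 3 powr (- (1 / 2))"
  have c: "c > 0" unfolding c_def using powr_less_mono[of "- (1 / 2)" 0 "3::real"] by simp
  have far: "c \<le> norm (1 - 3 powr (- s) :: complex)" if "Re s > 1 / 2" for s
  proof -
    have "norm (3 powr (- s) :: complex) = 3 powr (- Re s)"
      by (simp add: norm_powr_real_powr)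
    also have "\<dots> \<le> 3 powr (- (1 / 2))"
      using that by (intro powr_mono) auto
    finally show ?thesis
      using norm_triangle_ineq2[of 1 "3 powr (- s) :: complex"] by (simp add: c_def)
  qed
  have nz: "1 - 3 powr (- s) \<noteq> (0::complex)" if "Re s > 1 / 2" for s
    using far[OF that] c by auto
  show ?thesis
  proof (rule moebius_twisted_sum_bound[where L = "\<lambda>s. L3 s / (1 - 3 powr (- s))" and G = "\<lambda>s. (1 - 3 powr (- s)) / L3 s"])
    show "(\<lambda>s. L3 s / (1 - 3 powr (- s))) holomorphic_on {s. Re s > 1 / 2} - {1}"
      using nz by (intro holomorphic_intros holomorphic_on_subset[OF holomorphic_L3]) auto
    show "(\<lambda>s. (1 - 3 powr (- s)) / L3 s) holomorphic_on {s. Re s > 1 / 2}"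
      using L3_nonzero[OF assms(1)]
      by (intro holomorphic_intros holomorphic_on_subset[OF holomorphic_L3]) auto
    show "L3 s / (1 - 3 powr (- s)) \<noteq> 0" if "Re s > 1 / 2" "s \<noteq> 1" for s
      using L3_nonzero[OF assms(1) that(1)] nz[OF that(1)] by simp
    show "L3 s / (1 - 3 powr (- s)) = (\<Sum>n. g3 (Suc n) * of_nat (Suc n) powr (- s))" if "Re s > 1" for s
      using g3_series[OF that] nz[of s] that by (simp add: divide_eq_eq)
    show "\<exists>C. \<forall>s. \<sigma> \<le> Re s \<longrightarrow> 1 \<le> \<bar>Im s\<bar> \<longrightarrow> norm (L3 s / (1 - 3 powr (- s))) \<le> C * (1 + norm s) ^ 2"
      if \<sigma>: "\<sigma> > 1 / 2" for \<sigma>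
    proof -
      obtain C where C: "\<And>s. \<sigma> \<le> Re s \<Longrightarrow> norm (L3 s) \<le> C * (1 + norm s) ^ 2"
        using L3_growth[of \<sigma>] \<sigma> by auto
      have "norm (L3 s / (1 - 3 powr (- s))) \<le> C / c * (1 + norm s) ^ 2" if s: "\<sigma> \<le> Re s" for s
      proof -
        have "norm (L3 s / (1 - 3 powr (- s))) \<le> norm (L3 s) / c"
          unfolding norm_divide using far[of s] less_le_trans[OF c far[of s]] s \<sigma> c by (intro divide_left_mono mult_pos_pos) auto
        also have "\<dots> \<le> C * (1 + norm s) ^ 2 / c"
          using C[OF s] c by (intro divide_right_mono) auto
        finally show ?thesis by simp
      qed
      then show ?thesis by blast
    qed
  qed (use assms g3_1 g3_mult norm_g3_le in auto)
qed

section \<open>The hyperbola method\<close>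

lemma sum_chi3: "(\<Sum>n=1..N. chi3 n) = (if N mod 3 = 1 then 1 else 0)"
proof (induction N)
  case (Suc N)
  have "N mod 3 = 0 \<or> N mod 3 = 1 \<or> N mod 3 = 2"
    by linarith
  then show ?case
    unfolding sum.atLeast1_atMost_eq[symmetric] using Suc
    by (auto simp: chi3_def mod_Suc)
qed simp

lemma sum_g3_rec: "(\<Sum>n=1..N. g3 n) = (\<Sum>n=1..N. chi3 n) + (\<Sum>n=1..N div 3. g3 n)"
proof -
  have "(\<Sum>n=1..N. g3 n) = (\<Sum>n | n \<in> {1..N} \<and> \<not> 3 dvd n. g3 n) + (\<Sum>n | n \<in> {1..N} \<and> 3 dvd n. g3 n)"
    by (subst sum.union_disjoint[symmetric]) (auto intro!: sum.cong)
  also have "(\<Sum>n | n \<in> {1..N} \<and> \<not> 3 dvd n. g3 n) = (\<Sum>n=1..N. chi3 n)"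
    by (intro sum.mono_neutral_cong_left) (auto simp: g3_not_dvd chi3_eq_0_iff)
  also have "(\<Sum>n | n \<in> {1..N} \<and> 3 dvd n. g3 n) = (\<Sum>n=1..N div 3. g3 n)"
    by (rule sum.reindex_bij_witness[of _ "\<lambda>m. 3 * m" "\<lambda>n. n div 3"]) (auto simp: g3_mult g3_3)
  finally show ?thesis .
qed

text \<open>Unfolding \<open>sum_g3_rec\<close> takes about log N steps, each adding at most 1. For
  the induction the constant \<open>C\<close> is chosen to solve
  \<open>1 + C * 3 powr (- \<epsilon>) = C\<close>, with the added 1 absorbed into
  \<open>real N powr \<epsilon>\<close>.\<close>

lemma sum_g3_bound:
  fixes \<epsilon> :: real
  assumes "\<epsilon> > 0"
  shows "norm (\<Sum>n=1..N. g3 n) \<le> 1 / (1 - 3 powr (- \<epsilon>)) * real N powr \<epsilon>"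
proof (induction N rule: less_induct)
  case (less N)
  define c where "c = 1 - (3::real) powr (- \<epsilon>)"
  have c: "c > 0" unfolding c_def using powr_less_mono[of "- \<epsilon>" 0 "3::real"] assms by simp
  show ?case
  proof (cases "N = 0")
    case False
    have "norm (\<Sum>n=1..N. g3 n) \<le> norm (\<Sum>n=1..N. chi3 n) + norm (\<Sum>n=1..N div 3. g3 n)"
      unfolding sum_g3_rec[of N] by (rule norm_triangle_ineq)
    also have "\<dots> \<le> 1 + 1 / c * real (N div 3) powr \<epsilon>"
    proof (rule add_mono)
      show "norm (\<Sum>n=1..N. chi3 n) \<le> 1"
        unfolding sum_chi3 by simp
      show "norm (\<Sum>n=1..N div 3. g3 n) \<le> 1 / c * real (N div 3) powr \<epsilon>"
        unfolding c_def using False by (intro less.IH) simp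
    qed
    also have "\<dots> \<le> real N powr \<epsilon> + 1 / c * (real N / 3) powr \<epsilon>"
    proof (intro add_mono mult_left_mono powr_mono2)
      show "1 \<le> real N powr \<epsilon>"
        using False assms by (intro ge_one_powr_ge_zero) auto
      show "real (N div 3) \<le> real N / 3"
        using of_nat_div_le_of_nat[of N 3, where 'a = real] by simp
    qed (use assms c in auto)
    also have "(real N / 3) powr \<epsilon> = (1 - c) * real N powr \<epsilon>"
      by (simp add: powr_divide c_def powr_minus field_simps)
    also have "real N powr \<epsilon> + 1 / c * ((1 - c) * real N powr \<epsilon>) = 1 / c * real N powr \<epsilon>"
      using c by (simp add: field_simps)
    finally show ?thesis by (simp add: c_def)
  qed simp
qed

text \<open>Splitting off \<open>m powr (- (1 + \<epsilon>))\<close>, whose sum converges, and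
  bounding the rest at \<open>m = M\<close> loses only \<open>M powr \<epsilon>\<close> against the
  expected \<open>M powr (1 - \<beta>)\<close>.\<close>

lemma sum_powr_minus_le:
  fixes \<beta> \<epsilon> :: real
  assumes "\<epsilon> > 0" "\<beta> \<le> 1 + \<epsilon>"
  shows "(\<Sum>m=1..M. real m powr (- \<beta>)) \<le> (\<Sum>n. real (Suc n) powr (- (1 + \<epsilon>))) * real M powr (1 + \<epsilon> - \<beta>)"
proof -
  have sm: "summable (\<lambda>n. real (Suc n) powr (- (1 + \<epsilon>)))"
    using assms by (intro summable_Suc_powr) auto
  have "(\<Sum>m=1..M. real m powr (- \<beta>)) \<le> (\<Sum>m=1..M. real m powr (- (1 + \<epsilon>)) * real M powr (1 + \<epsilon> - \<beta>))"
  proof (rule sum_mono)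
    fix m assume m: "m \<in> {1..M}"
    have "real m powr (- \<beta>) = real m powr (- (1 + \<epsilon>)) * real m powr (1 + \<epsilon> - \<beta>)"
      by (simp flip: powr_add)
    also have "\<dots> \<le> real m powr (- (1 + \<epsilon>)) * real M powr (1 + \<epsilon> - \<beta>)"
      using m assms by (intro mult_left_mono powr_mono2) auto
    finally show "real m powr (- \<beta>) \<le> real m powr (- (1 + \<epsilon>)) * real M powr (1 + \<epsilon> - \<beta>)" .
  qed
  also have "\<dots> = (\<Sum>m=1..M. real m powr (- (1 + \<epsilon>))) * real M powr (1 + \<epsilon> - \<beta>)"
    by (rule sum_distrib_right[symmetric])
  also have "(\<Sum>m=1..M. real m powr (- (1 + \<epsilon>))) = (\<Sum>n<M. real (Suc n) powr (- (1 + \<epsilon>)))"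
    by (simp add: sum.atLeast1_atMost_eq)
  also have "\<dots> * real M powr (1 + \<epsilon> - \<beta>) \<le> (\<Sum>n. real (Suc n) powr (- (1 + \<epsilon>))) * real M powr (1 + \<epsilon> - \<beta>)"
    by (intro mult_right_mono sum_le_suminf sm) auto
  finally show ?thesis .
qed

lemma power_times_le_iff:
  fixes d m k N :: nat
  assumes "m > 0" "k > 0"
  shows "d ^ k * m \<le> N \<longleftrightarrow> d \<le> nat \<lfloor>(real N / real m) powr (1 / real k)\<rfloor>"
proof -
  have "d ^ k * m \<le> N \<longleftrightarrow> real d ^ k \<le> real N / real m"
    using assms by (simp add: le_divide_eq flip: of_nat_power of_nat_mult)
  also have "real N / real m = ((real N / real m) powr (1 / real k)) powr real k"
    using assms by (simp add: powr_powr)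
  also have "\<dots> = ((real N / real m) powr (1 / real k)) ^ k"
    using assms by (intro powr_realpow') auto
  also have "real d ^ k \<le> \<dots> \<longleftrightarrow> real d \<le> (real N / real m) powr (1 / real k)"
    using assms by (intro power_mono_iff) auto
  also have "\<dots> \<longleftrightarrow> d \<le> nat \<lfloor>(real N / real m) powr (1 / real k)\<rfloor>"
    by (simp add: le_nat_floor le_nat_iff le_floor_iff)
  finally show ?thesis .
qed

text \<open>For small \<open>d\<close> the inner sum over \<open>m\<close> costs only
  \<open>N powr \<epsilon>\<close>, so the number of \<open>d\<close> decides. For large
  \<open>d\<close> there are few \<open>m\<close>, and the cancellation in \<open>b\<close> is used
  up to the k-th root of \<open>N / m\<close>. The outer sums are estimated trivially.\<close>

lemma hyperbola_bound:
  fixes b g :: "nat \<Rightarrow> complex" and k :: nat and \<epsilon> C1 C2 :: real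
  assumes k: "k \<ge> 2" and \<epsilon>: "\<epsilon> > 0" and b1: "\<And>d. norm (b d) \<le> 1" and g1: "\<And>m. norm (g m) \<le> 1"
    and g: "\<And>N. norm (\<Sum>m=1..N. g m) \<le> C1 * real N powr \<epsilon>"
    and b: "\<And>N. norm (\<Sum>d=1..N. b d) \<le> C2 * real N powr (1 / 2 + \<epsilon>)"
  shows "\<exists>C. \<forall>N. norm (\<Sum>(d, m) | d > 0 \<and> m > 0 \<and> d ^ k * m \<le> N. b d * g m)
           \<le> C * real N powr (1 / (real k + 1 / 2) + \<epsilon>)"
proof -
  define \<kappa> where "\<kappa> = real k + 1 / 2"
  \<comment> \<open>The sum of \<open>b\<close> up to the k-th root of \<open>N / m\<close> is
    bounded by a multiple of \<open>(N / m) powr \<beta>\<close>.\<close>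
  define \<beta> where "\<beta> = (1 / 2 + \<epsilon>) / real k"
  define Z where "Z = (\<Sum>n. real (Suc n) powr (- (1 + \<epsilon>)))"
  have \<kappa>: "\<kappa> \<ge> 5 / 2" using k by (simp add: \<kappa>_def)
  have \<beta>: "0 < \<beta>" "\<beta> \<le> 1 + \<epsilon>" "real k * \<beta> = 1 / 2 + \<epsilon>"
  proof -
    show "0 < \<beta>" "real k * \<beta> = 1 / 2 + \<epsilon>" using k \<epsilon> by (simp_all add: \<beta>_def)
    have "\<beta> \<le> (1 / 2 + \<epsilon>) / 1"
      unfolding \<beta>_def using k \<epsilon> by (intro divide_left_mono) auto
    then show "\<beta> \<le> 1 + \<epsilon>" by simp
  qed
  have C1: "C1 \<ge> 0" using order_trans[OF norm_ge_zero g[of 1]] by simp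
  have C2: "C2 \<ge> 0" using order_trans[OF norm_ge_zero b[of 1]] by simp
  have Z: "Z \<ge> 0" unfolding Z_def using \<epsilon> by (intro suminf_nonneg summable_Suc_powr) auto
  have "norm (\<Sum>(d, m) | d > 0 \<and> m > 0 \<and> d ^ k * m \<le> N. b d * g m)
     \<le> (2 * C1 + 2 * C2 * Z) * real N powr (1 / \<kappa> + \<epsilon>)" for N
  proof (cases "N = 0")
    case True
    then have E: "{(d, m). d > 0 \<and> m > 0 \<and> d ^ k * m \<le> N} = {}" by auto
    show ?thesis unfolding E using True by simp
  next
    case N: False
    \<comment> \<open>The exponent makes \<open>N / X ^ k\<close> equal to
      \<open>X powr (1 / 2)\<close>; rounding up in \<open>Y\<close> keeps \<open>M\<close> below
      that value.\<close>
    define X where "X = real N powr (1 / \<kappa>)"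
    define Y where "Y = nat \<lceil>X\<rceil>"
    define M where "M = N div Y ^ k"
    define D where "D = (\<lambda>m. nat \<lfloor>(real N / real m) powr (1 / real k)\<rfloor>)"
    have X: "X \<ge> 1" unfolding X_def using N \<kappa> by (intro ge_one_powr_ge_zero) auto
    have NX: "real N = X powr \<kappa>" using N \<kappa> by (simp add: X_def powr_powr)
    have Y: "X \<le> real Y" "real Y \<le> 2 * X" "Y > 0" using X by (auto simp: Y_def) linarith+
    have MX: "real M \<le> X powr (1 / 2)"
    proof -
      have "real M \<le> real N / real Y ^ k"
        unfolding M_def using of_nat_div_le_of_nat[of N "Y ^ k", where 'a = real] by simp
      also have "\<dots> \<le> real N / X ^ k"
        using X Y by (intro divide_left_mono power_mono mult_pos_pos) auto
      also have "\<dots> = X powr (\<kappa> - real k)"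
        using X by (simp add: NX powr_diff powr_realpow)
      finally show ?thesis by (simp add: \<kappa>_def)
    qed
    have D: "d ^ k * m \<le> N \<longleftrightarrow> d \<le> D m" if "m > 0" for d m
      unfolding D_def using that k by (intro power_times_le_iff) auto
    have fin: "finite {(d, m). d > 0 \<and> m > 0 \<and> d ^ k * m \<le> N}"
    proof (rule finite_subset)
      show "{(d, m). d > 0 \<and> m > 0 \<and> d ^ k * m \<le> N} \<subseteq> {..N} \<times> {..N}"
      proof clarsimp
        fix d m :: nat assume *: "0 < d" "0 < m" "d ^ k * m \<le> N"
        have "d \<le> d ^ k * 1" using * k by (simp add: self_le_power)
        also have "\<dots> \<le> d ^ k * m" using * by (intro mult_left_mono) auto
        also note *(3)
        finally have "d \<le> N" .
        have "1 * m \<le> d ^ k * m" using * by (intro mult_right_mono) auto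
        also note *(3)
        finally have "m \<le> N" by simp
        with \<open>d \<le> N\<close> show "d \<le> N \<and> m \<le> N" ..
      qed
    qed auto
    \<comment> \<open>A pair with \<open>d > Y\<close> has \<open>m \<le> M\<close>. That piece is
      indexed by \<open>m\<close> first, so that the sum over \<open>d\<close> becomes the inner
      one.\<close>
    have split: "{(d, m). d > 0 \<and> m > 0 \<and> d ^ k * m \<le> N} =
        Sigma {1..Y} (\<lambda>d. {1..N div d ^ k}) \<union> (\<lambda>(m, d). (d, m)) ` Sigma {1..M} (\<lambda>m. {Y<..D m})"
      (is "?P = ?P1 \<union> ?sw ` ?P2")
    proof (intro equalityI subsetI)
      fix p assume "p \<in> ?P"
      then obtain d m where p: "p = (d, m)" "d > 0" "m > 0" "d ^ k * m \<le> N" by auto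
      show "p \<in> ?P1 \<union> ?sw ` ?P2"
      proof (cases "d \<le> Y")
        case True
        then show ?thesis using p by (auto simp: less_eq_div_iff_mult_less_eq mult.commute)
      next
        case False
        then have "m * Y ^ k \<le> m * d ^ k" by (intro mult_left_mono power_mono) auto
        also have "\<dots> \<le> N" using p(4) by (simp only: mult.commute)
        finally have "m \<le> M"
          using Y(3) unfolding M_def by (subst less_eq_div_iff_mult_less_eq) auto
        then show ?thesis using p False D[of m d] by force
      qed
    next
      fix p assume "p \<in> ?P1 \<union> ?sw ` ?P2"
      then show "p \<in> ?P"
        using D by (auto simp: less_eq_div_iff_mult_less_eq mult.commute)
    qed
    have "(\<Sum>(d, m)\<in>?P. b d * g m) = (\<Sum>(d, m)\<in>?P1. b d * g m) + (\<Sum>(d, m)\<in>?sw ` ?P2. b d * g m)"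
      unfolding split by (intro sum.union_disjoint) auto
    also have "(\<Sum>(d, m)\<in>?P1. b d * g m) = (\<Sum>d=1..Y. b d * (\<Sum>m=1..N div d ^ k. g m))"
      by (subst sum.Sigma[symmetric]) (auto simp: sum_distrib_left)
    also have "(\<Sum>(d, m)\<in>?sw ` ?P2. b d * g m) = (\<Sum>(m, d)\<in>?P2. b d * g m)"
      by (subst sum.reindex) (auto simp: inj_on_def intro!: sum.cong)
    also have "\<dots> = (\<Sum>m=1..M. (\<Sum>d\<in>{Y<..D m}. b d) * g m)"
      by (subst sum.Sigma[symmetric]) (auto simp: sum_distrib_right)
    finally have eq: "(\<Sum>(d, m)\<in>?P. b d * g m) = (\<Sum>d=1..Y. b d * (\<Sum>m=1..N div d ^ k. g m))
        + (\<Sum>m=1..M. (\<Sum>d\<in>{Y<..D m}. b d) * g m)" .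
    have "norm (\<Sum>d=1..Y. b d * (\<Sum>m=1..N div d ^ k. g m)) \<le> (\<Sum>d=1..Y. C1 * real N powr \<epsilon>)"
    proof (intro sum_norm_le)
      fix d
      have "norm (b d * (\<Sum>m=1..N div d ^ k. g m)) \<le> 1 * (C1 * real (N div d ^ k) powr \<epsilon>)"
        unfolding norm_mult by (intro mult_mono b1 g) auto
      also have "\<dots> \<le> C1 * real N powr \<epsilon>"
        using C1 \<epsilon> by (auto intro!: mult_left_mono powr_mono2)
      finally show "norm (b d * (\<Sum>m=1..N div d ^ k. g m)) \<le> C1 * real N powr \<epsilon>" .
    qed
    also have "\<dots> = real Y * (C1 * real N powr \<epsilon>)" by simp
    also have "\<dots> \<le> (2 * X) * (C1 * real N powr \<epsilon>)"
      using Y C1 by (intro mult_right_mono) auto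
    finally have b1: "norm (\<Sum>d=1..Y. b d * (\<Sum>m=1..N div d ^ k. g m)) \<le> 2 * C1 * (X * real N powr \<epsilon>)"
      by (simp only: mult_ac)
    have "norm (\<Sum>m=1..M. (\<Sum>d\<in>{Y<..D m}. b d) * g m) \<le> (\<Sum>m=1..M. 2 * C2 * real N powr \<beta> * real m powr (- \<beta>))"
    proof (intro sum_norm_le)
      fix m assume "m \<in> {1..M}"
      then have m: "m > 0" by simp
      have "norm (\<Sum>d\<in>{Y<..D m}. b d) \<le> 2 * C2 * real N powr \<beta> * real m powr (- \<beta>)"
      proof (cases "Y < D m")
        case True
        then have "{1..D m} = {1..Y} \<union> {Y<..D m}" by auto
        then have "(\<Sum>d=1..D m. b d) = (\<Sum>d=1..Y. b d) + (\<Sum>d\<in>{Y<..D m}. b d)"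
          by (simp only:) (intro sum.union_disjoint, auto)
        then have "norm (\<Sum>d\<in>{Y<..D m}. b d) = norm ((\<Sum>d=1..D m. b d) - (\<Sum>d=1..Y. b d))"
          by simp
        also have "\<dots> \<le> norm (\<Sum>d=1..D m. b d) + norm (\<Sum>d=1..Y. b d)"
          by (rule norm_triangle_ineq4)
        \<comment> \<open>Since \<open>Y < D m\<close>, the sum up to \<open>Y\<close> may be
          charged to \<open>D m\<close> as well.\<close>
        also have "\<dots> \<le> C2 * real (D m) powr (1 / 2 + \<epsilon>) + C2 * real (D m) powr (1 / 2 + \<epsilon>)"
          using True C2 \<epsilon> by (intro add_mono b order_trans[OF b] mult_left_mono powr_mono2) auto
        also have "\<dots> = 2 * C2 * real (D m) powr (1 / 2 + \<epsilon>)" by simp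
        also have "\<dots> \<le> 2 * C2 * ((real N / real m) powr (1 / real k)) powr (1 / 2 + \<epsilon>)"
          using C2 \<epsilon> unfolding D_def by (intro mult_left_mono powr_mono2) (auto simp: of_nat_floor)
        also have "((real N / real m) powr (1 / real k)) powr (1 / 2 + \<epsilon>) = (real N / real m) powr \<beta>"
          by (simp add: powr_powr \<beta>_def)
        also have "\<dots> = real N powr \<beta> * real m powr (- \<beta>)"
          by (simp add: powr_divide powr_minus field_simps)
        finally show ?thesis by (simp only: mult.assoc)
      qed (use C2 in simp)
      from mult_mono[OF this g1[of m]]
      show "norm ((\<Sum>d\<in>{Y<..D m}. b d) * g m) \<le> 2 * C2 * real N powr \<beta> * real m powr (- \<beta>)"
        using C2 by (simp add: norm_mult)
    qed
    also have "\<dots> = 2 * C2 * real N powr \<beta> * (\<Sum>m=1..M. real m powr (- \<beta>))"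
      by (rule sum_distrib_left[symmetric])
    also have "\<dots> \<le> 2 * C2 * real N powr \<beta> * (Z * real M powr (1 + \<epsilon> - \<beta>))"
      unfolding Z_def using C2 \<epsilon> \<beta> by (intro mult_left_mono sum_powr_minus_le) auto
    also have "\<dots> \<le> 2 * C2 * real N powr \<beta> * (Z * (X powr (1 / 2)) powr (1 + \<epsilon> - \<beta>))"
      using C2 Z MX \<beta> by (intro mult_left_mono powr_mono2) auto
    also have "\<dots> = 2 * C2 * Z * X powr (\<kappa> * \<beta> + 1 / 2 * (1 + \<epsilon> - \<beta>))"
      unfolding NX by (simp only: powr_powr powr_add mult_ac)
    \<comment> \<open>The terms \<open>\<beta> / 2\<close> cancel, and
      \<open>real k * \<beta>\<close> is \<open>1 / 2 + \<epsilon>\<close>. The surplus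
      \<open>3 / 2 * \<epsilon>\<close> fits into \<open>\<kappa> * \<epsilon>\<close> as
      \<open>\<kappa> \<ge> 5 / 2\<close>, and \<open>X powr \<kappa>\<close> is
      \<open>N\<close>.\<close>
    also have "\<kappa> * \<beta> + 1 / 2 * (1 + \<epsilon> - \<beta>) = 1 + 3 / 2 * \<epsilon>"
      using \<beta>(3) by (simp add: \<kappa>_def field_simps)
    also have "2 * C2 * Z * X powr (1 + 3 / 2 * \<epsilon>) \<le> 2 * C2 * Z * X powr (1 + \<kappa> * \<epsilon>)"
      using C2 Z X \<kappa> \<epsilon> by (intro mult_left_mono powr_mono add_mono mult_right_mono) auto
    also have "X powr (1 + \<kappa> * \<epsilon>) = X * real N powr \<epsilon>"
      using X by (simp add: NX powr_add powr_powr)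
    finally have b2: "norm (\<Sum>m=1..M. (\<Sum>d\<in>{Y<..D m}. b d) * g m) \<le> 2 * C2 * Z * (X * real N powr \<epsilon>)" .
    have "norm (\<Sum>(d, m)\<in>?P. b d * g m) \<le> 2 * C1 * (X * real N powr \<epsilon>) + 2 * C2 * Z * (X * real N powr \<epsilon>)"
      unfolding eq by (rule order_trans[OF norm_triangle_ineq add_mono[OF b1 b2]])
    also have "\<dots> = (2 * C1 + 2 * C2 * Z) * (X * real N powr \<epsilon>)"
      by (simp add: algebra_simps)
    also have "X * real N powr \<epsilon> = real N powr (1 / \<kappa> + \<epsilon>)"
      by (simp add: X_def powr_add)
    finally show ?thesis .
  qed
  then show ?thesis unfolding \<kappa>_def by blast
qed

section \<open>The k-free sum as a convolution\<close>

lemma sum_k_free_eq: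
  assumes k: "k > 0"
  shows "(\<Sum>n=1..N. if k_free k n then g3 n else 0) =
    (\<Sum>(d, m) | d > 0 \<and> m > 0 \<and> d ^ k * m \<le> N. of_int (moebius_mu d) * g3 d ^ k * g3 m)"
proof -
  let ?b = "\<lambda>d. of_int (moebius_mu d) * g3 d ^ k"
  let ?D = "\<lambda>n. {d. d ^ k dvd n}"
  have g3_power: "g3 (d ^ j) = g3 d ^ j" for d j
    using g3_1 by (induction j) (simp_all add: g3_mult)
  have "(if k_free k n then g3 n else 0) = (\<Sum>d\<in>?D n. ?b d * g3 (n div d ^ k))" if n: "n \<in> {1..N}" for n
  proof -
    have "(\<Sum>d\<in>?D n. ?b d * g3 (n div d ^ k)) = (\<Sum>d\<in>?D n. of_int (moebius_mu d) * g3 n)"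
    proof (rule sum.cong)
      fix d assume "d \<in> ?D n"
      then have "n = d ^ k * (n div d ^ k)" by simp
      then have "g3 n = g3 d ^ k * g3 (n div d ^ k)"
        by (metis g3_mult g3_power)
      then show "?b d * g3 (n div d ^ k) = of_int (moebius_mu d) * g3 n" by simp
    qed simp
    also have "\<dots> = of_int (\<Sum>d\<in>?D n. moebius_mu d) * g3 n"
      by (simp add: sum_distrib_right)
    also have "\<dots> = (if k_free k n then g3 n else 0)"
      using n k by (subst sum_moebius_power_divisors) (auto simp: k_free_def)
    finally show ?thesis ..
  qed
  then have "(\<Sum>n=1..N. if k_free k n then g3 n else 0) = (\<Sum>n=1..N. \<Sum>d\<in>?D n. ?b d * g3 (n div d ^ k))"
    by (rule sum.cong[OF refl])
  also have "\<dots> = (\<Sum>(n, d)\<in>Sigma {1..N} ?D. ?b d * g3 (n div d ^ k))"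
  proof (rule sum.Sigma)
    show "\<forall>n\<in>{1..N}. finite (?D n)"
    proof
      fix n assume n: "n \<in> {1..N}"
      have "d \<le> n" if "d ^ k dvd n" for d
      proof (cases "d = 0")
        case False
        then have "d \<le> d ^ k" using k by (simp add: self_le_power)
        also have "\<dots> \<le> n" using that n by (intro dvd_imp_le) auto
        finally show ?thesis .
      qed simp
      then show "finite (?D n)"
        using finite_subset[of "?D n" "{..n}"] by auto
    qed
  qed simp
  also have "\<dots> = (\<Sum>(d, m) | d > 0 \<and> m > 0 \<and> d ^ k * m \<le> N. ?b d * g3 m)"
    by (rule sum.reindex_bij_witness[of _ "\<lambda>(d, m). (d ^ k * m, d)" "\<lambda>(n, d). (d, n div d ^ k)"])
       (use k in \<open>auto intro!: Nat.gr0I elim!: dvdE simp: Suc_le_eq\<close>)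
  finally show ?thesis .
qed

lemma sum_moebius_g3_power_bound:
  assumes GRH: "Generalized_Riemann_Hypothesis" and \<epsilon>: "\<epsilon> > 0"
  shows "\<exists>C. \<forall>N. norm (\<Sum>d=1..N. of_int (moebius_mu d) * g3 d ^ k) \<le> C * real N powr (1 / 2 + \<epsilon>)"
proof -
  have z: "zeros_on_critical_line (\<lambda>_. 1)" "zeros_on_critical_line chi3"
    using GRH dirichlet_character_chi3 unfolding Generalized_Riemann_Hypothesis_def by blast+
  have "g3 d ^ k = (if even k then 1 else g3 d)" if "d > 0" for d
    using g3_values[OF that] by auto
  then have "(\<Sum>d=1..N. of_int (moebius_mu d) * g3 d ^ k) =
     (if even k then \<Sum>d=1..N. of_int (moebius_mu d) else \<Sum>d=1..N. of_int (moebius_mu d) * g3 d)" for N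
    by (auto intro!: sum.cong)
  then show ?thesis
    using mertens_bound[OF z(1) \<epsilon>] mertens_bound_g3[OF z(2) \<epsilon>] by (cases "even k") auto
qed

text \<open>A prime divides at most one of two coprime numbers, so its k-th power cannot be spread
  over both.\<close>

lemma k_free_mult_coprime:
  assumes "coprime m n"
  shows "k_free k (m * n) \<longleftrightarrow> k_free k m \<and> k_free k n"
proof -
  have "p ^ k dvd m * n \<longleftrightarrow> p ^ k dvd m \<or> p ^ k dvd n" if p: "prime p" for p
  proof
    assume *: "p ^ k dvd m * n"
    from assms p have "\<not> p dvd m \<or> \<not> p dvd n"
      using coprime_common_divisor not_prime_unit by blast
    then have "coprime (p ^ k) m \<or> coprime (p ^ k) n"
      using p by (auto intro: prime_imp_coprime)
    then show "p ^ k dvd m \<or> p ^ k dvd n"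
      using * by (auto simp: coprime_dvd_mult_left_iff coprime_dvd_mult_right_iff)
  qed auto
  then show ?thesis unfolding k_free_def by blast
qed

theorem theorem1p2:
  fixes k :: nat
  assumes "Generalized_Riemann_Hypothesis"
    and "k \<ge> 2"
  shows "\<exists>f :: nat \<Rightarrow> complex.
           multiplicative f \<and>
           (\<forall>n>0. f n \<in> {-1, 0, 1}) \<and>
           supported_on_k_free k f \<and>
           (\<forall>p. prime p \<longrightarrow> f p \<in> {-1, 1}) \<and>
           (\<forall>\<epsilon>::real. \<epsilon> > 0 \<longrightarrow>
              (\<lambda>x::real. \<Sum>n | 0 < n \<and> real n \<le> x. f n)
                \<in> O(\<lambda>x. complex_of_real (x powr (1 / (real k + 1 / 2) + \<epsilon>))))"
proof -
  define f where "f = (\<lambda>n. if k_free k n then g3 n else 0)"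
  have "multiplicative f"
    unfolding multiplicative_def f_def by (auto simp: k_free_mult_coprime g3_mult)
  moreover have "\<forall>n>0. f n \<in> {-1, 0, 1}"
    using g3_values by (auto simp: f_def)
  moreover have "supported_on_k_free k f"
    by (simp add: supported_on_k_free_def f_def)
  moreover have "\<forall>p. prime p \<longrightarrow> f p \<in> {-1, 1}"
  proof (intro allI impI)
    fix p :: nat assume p: "prime p"
    \<comment> \<open>As \<open>k \<ge> 2\<close>, a k-th prime power dividing \<open>p\<close>
      would contradict squarefreeness; hence primes are k-free and \<open>f p\<close> is
      \<open>g3 p\<close>.\<close>
    have "\<not> q ^ k dvd p" if q: "prime q" for q
    proof
      assume *: "q ^ k dvd p"
      have "q ^ 2 dvd q ^ k" using assms(2) by (rule le_imp_power_dvd)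
      then have "q ^ 2 dvd p" using * by (rule dvd_trans)
      then show False
        using p q squarefree_prime[OF p] squarefreeD[of p q] by (auto dest: not_prime_unit)
    qed
    then show "f p \<in> {-1, 1}"
      using g3_values[of p] p by (auto simp: f_def k_free_def prime_gt_0_nat)
  qed
  moreover have "(\<lambda>x::real. \<Sum>n | 0 < n \<and> real n \<le> x. f n)
                \<in> O(\<lambda>x. complex_of_real (x powr (1 / (real k + 1 / 2) + \<epsilon>)))" if \<epsilon>: "\<epsilon> > 0" for \<epsilon>
  proof -
    define e where "e = 1 / (real k + 1 / 2) + \<epsilon>"
    obtain C2 where C2: "\<And>N. norm (\<Sum>d=1..N. of_int (moebius_mu d) * g3 d ^ k) \<le> C2 * real N powr (1 / 2 + \<epsilon>)"
      using sum_moebius_g3_power_bound[OF assms(1) \<epsilon>] by blast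
    have b1: "norm (of_int (moebius_mu d) * g3 d ^ k) \<le> 1" for d
      using mult_mono[of "norm (of_int (moebius_mu d) :: complex)" 1 "norm (g3 d ^ k)" 1]
        abs_moebius_mu_le[of d] power_le_one[of "norm (g3 d)" k] norm_g3_le[of d]
      by (simp add: norm_mult norm_power)
    obtain C where C: "\<And>N. norm (\<Sum>n=1..N. f n) \<le> C * real N powr e"
      using hyperbola_bound[OF assms(2) \<epsilon> b1 norm_g3_le sum_g3_bound[OF \<epsilon>] C2] assms(2)
      unfolding f_def e_def by (subst (asm) sum_k_free_eq[symmetric]) auto
    have e: "e \<ge> 0" using \<epsilon> by (simp add: e_def)
    have C0: "C \<ge> 0" using order_trans[OF norm_ge_zero C[of 1]] by simp
    show ?thesis
      unfolding e_def[symmetric]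
    proof (rule bigoI)
      show "\<forall>\<^sub>F x in at_top. norm (\<Sum>n | 0 < n \<and> real n \<le> x. f n) \<le> C * norm (complex_of_real (x powr e))"
        using eventually_ge_at_top[of 0]
      proof eventually_elim
        case (elim x)
        have "{n. 0 < n \<and> real n \<le> x} = {1..nat \<lfloor>x\<rfloor>}"
          using elim by (auto simp: le_nat_iff le_floor_iff)
        then have "norm (\<Sum>n | 0 < n \<and> real n \<le> x. f n) \<le> C * real (nat \<lfloor>x\<rfloor>) powr e"
          using C[of "nat \<lfloor>x\<rfloor>"] by simp
        also have "\<dots> \<le> C * x powr e"
          using elim e C0 by (intro mult_left_mono powr_mono2) auto
        finally show ?case by simp
      qed
    qed
  qed
  ultimately show ?thesis by blast
qed

end
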